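(* Let $S=S_1S_2S_3\cdots$ be the sequence defined in the context. For almost every $n$ (i.e. all sufficiently large $n$), the number of output bits contributed by $\mathrm{PPM}^*$ when encoding the segment $S_n$, given that it has already processed $S_1S_2\cdots S_{n-1}$, satisfies $$|\mathrm{PPM}^*(S_n\mid S_1\cdots S_{n-1})|\le (2^n+2n+n^2)\log(n^5)+\log\big((n-1)^n n^{2^{n+1}}\big).$$
   Context: Strings are indexed from $0$; $x[i..j]$ is the substring from position $i$ to $j$; $x^j$ is $j$-fold concatenation; $\log$ is base $2$. de Bruijn strings: for $n\ge1$, a de Bruijn string of order $n$ is a binary string $x$ of length $2^n$ such that every $w\in\{0,1\}^n$ occurs exactly once as a substring of $x\cdot x[0..n-2]$. $db(n)$ is the lexicographically least one, produced by Martin's algorithm: start with $x=1^{n-1}$; while possible, append a bit (preferring $0$ over $1$) so that all length-$n$ substrings of $x$ remain distinct; then delete the prefix $1^{n-1}$. For $0\le i<2^n$, $db_i(n)=db(n)[i..2^n-1]\cdot db(n)[0..i-1]$. The sequence $S$: for $n\ge1$ write $n=2^st$ with $t$ odd, let $B_{n,i}=db_i(n)^t$ for $0\le i<2^s$, $S_n=B_{n,0}B_{n,1}\cdots B_{n,2^s-1}$, and $S=S_1S_2\cdots$. The $\mathrm{PPM}^*$ compressor (without exclusion, escape Method C) on binary input: after reading a prefix $x$, each stored context $c$ has, for each bit $b$, a frequency count equal to the number of occurrences of $cb$ in $x$, and an escape count equal to the number of distinct bits that have followed $c$ in $x$; deterministic means escape count $1$. The stored contexts are the empty context and, whenever a string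 $w$ occurs at least twice in $x$, the contexts $wb$ for each bit $b$ such that $wb$ occurs in $x$ followed by a further bit. Relevant contexts are stored contexts that are suffixes of $x$; the current context is the shortest deterministic relevant one, or the longest relevant one if none is deterministic. If the next bit $b$ has count $f>0$ in the current context it is encoded with probability $f/(T+e)$ ($T$ total bit count, $e$ escape count); otherwise an escape is encoded with probability $e/(T+e)$ and the next shorter relevant context becomes current; if $b$ is unseen even in the empty context, after the escape it is encoded with probability $1/2$. The model is then updated after each bit. The number of bits contributed by an encoded bit is $-\log$ of the product of the probabilities (escapes and symbol) used to encode it; $|\mathrm{PPM}^*(S_n\mid S_1\cdots S_{n-1})|$ is the sum of these over all bits of $S_n$ when $S$ is encoded sequentially. *)

theory Defs
  imports Complex_Main "HOL-Library.Sublist" "HOL-Computational_Algebra.Primes"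
begin

text \<open>Bits are booleans: False = 0, True = 1.\<close>

definition windows :: "nat \<Rightarrow> bool list \<Rightarrow> bool list list" where
  "windows n x = map (\<lambda>i. take n (drop i x)) [0..<Suc (length x) - n]"

definition martin_step :: "nat \<Rightarrow> bool list \<Rightarrow> bool list option" where
  "martin_step n x =
     (if distinct (windows n (x @ [False])) then Some (x @ [False])
      else if distinct (windows n (x @ [True])) then Some (x @ [True])
      else None)"

text \<open>Run the greedy appending with a fuel bound; each append creates one new
  length-n window and there are only 2^n distinct ones, so fuel 2^n suffices
  for the algorithm to reach the point where no bit can be appended.\<close>
fun martin_run :: "nat \<Rightarrow> nat \<Rightarrow> bool list \<Rightarrow> bool list" where
  "martin_run n 0 x = x"
| "martin_run n (Suc k) x =
     (case martin_step n x of None \<Rightarrow> x | Some y \<Rightarrow> martin_run n k y)"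

definition db :: "nat \<Rightarrow> bool list" where
  "db n = drop (n - 1) (martin_run n (2 ^ n) (replicate (n - 1) True))"

definition db_rot :: "nat \<Rightarrow> nat \<Rightarrow> bool list" where
  "db_rot n i = drop i (db n) @ take i (db n)"

definition S_seg :: "nat \<Rightarrow> bool list" where
  "S_seg n = (let s = multiplicity (2::nat) n; t = n div 2 ^ s in
      concat (map (\<lambda>i. concat (replicate t (db_rot n i))) [0..<2 ^ s]))"

definition S_prefix :: "nat \<Rightarrow> bool list" where
  "S_prefix n = concat (map S_seg [1..<n])"

section \<open>PPM* (no exclusion, escape method C)\<close>

definition occ :: "bool list \<Rightarrow> bool list \<Rightarrow> nat" where
  "occ w x = length (filter (\<lambda>i. take (length w) (drop i x) = w) [0..<Suc (length x) - length w])"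

definition freq :: "bool list \<Rightarrow> bool list \<Rightarrow> bool \<Rightarrow> nat" where
  "freq x c b = occ (c @ [b]) x"

definition tot :: "bool list \<Rightarrow> bool list \<Rightarrow> nat" where
  "tot x c = freq x c False + freq x c True"

definition esc :: "bool list \<Rightarrow> bool list \<Rightarrow> nat" where
  "esc x c = card {b. freq x c b > 0}"

definition deterministic :: "bool list \<Rightarrow> bool list \<Rightarrow> bool" where
  "deterministic x c \<longleftrightarrow> esc x c = 1"

text \<open>Stored contexts: the empty one, and w@[b] where w occurs at least twice in x
  and w@[b] occurs in x followed by a further bit (i.e. occurs in butlast x).\<close>
definition stored :: "bool list \<Rightarrow> bool list \<Rightarrow> bool" where
  "stored x c \<longleftrightarrow> c = [] \<or> (occ (butlast c) x \<ge> 2 \<and> 0 < occ c (butlast x))"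

definition relevant :: "bool list \<Rightarrow> bool list \<Rightarrow> bool" where
  "relevant x c \<longleftrightarrow> stored x c \<and> suffix c x"

definition sfx :: "bool list \<Rightarrow> nat \<Rightarrow> bool list" where
  "sfx x k = drop (length x - k) x"

definition rel_lens :: "bool list \<Rightarrow> nat set" where
  "rel_lens x = {k. k \<le> length x \<and> relevant x (sfx x k)}"

definition cur_len :: "bool list \<Rightarrow> nat" where
  "cur_len x =
     (if {k \<in> rel_lens x. deterministic x (sfx x k)} \<noteq> {}
      then Min {k \<in> rel_lens x. deterministic x (sfx x k)}
      else Max (rel_lens x))"

definition chain :: "bool list \<Rightarrow> nat list" where
  "chain x = filter (\<lambda>k. k \<in> rel_lens x \<and> k \<le> cur_len x) (rev [0..<Suc (length x)])"

fun enc :: "bool list \<Rightarrow> bool \<Rightarrow> nat list \<Rightarrow> real" where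
  "enc x b [] = 1"   \<comment> \<open>escaped from the empty context: probability 1/2\<close>
| "enc x b (k # ks) =
     (let c = sfx x k; f = freq x c b; T = tot x c; e = esc x c in
      if 0 < f then - log 2 (real f / real (T + e))
      else - log 2 (real e / real (T + e)) + enc x b ks)"

definition ppm_bit :: "bool list \<Rightarrow> bool \<Rightarrow> real" where
  "ppm_bit x b = enc x b (chain x)"

definition ppm_cost :: "bool list \<Rightarrow> bool list \<Rightarrow> real" where
  "ppm_cost x y = (\<Sum>i<length y. ppm_bit (x @ take i y) (y ! i))"

end

theory Submission
  imports Defs
begin

text \<open>
  Up to one dropped zero per copy, \<open>S\<^sub>n\<close> consists of \<open>n\<close> copies of \<open>D = db n\<close>, because \<open>D\<close> starts
  with \<open>0\<^sup>n\<close> and is rotated by at most \<open>n - 1\<close> positions. All words of length \<open>n - 1\<close> occur in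
  \<open>S\<^bsub>n-1\<^esub>\<close>, so contexts of length at most \<open>n - 2\<close> are not deterministic and at most one escape is needed
  per bit. Since the windows of a de Bruijn string are distinct, longer contexts have occurred only \<open>O(n\<^sup>2)\<close> times,
  so every bit costs at most \<open>log (n\<^sup>5)\<close>. Moreover \<open>D = 0\<^sup>n 1 0\<^bsup>n-2\<^esup> 1 \<dots>\<close>, and the word
  \<open>0\<^bsup>n-1\<^esup> 1 0\<^bsup>n-2\<^esup> 1\<close> occurs in \<open>S\<^sub>1 \<dots> S\<^sub>n\<close> only where a copy of \<open>D\<close> in \<open>S\<^sub>n\<close>, stripped of its first
  letter, starts. Hence, past these
  first \<open>2 n\<close> letters, the part of the current copy read so far is a deterministic context once one copy
  has been processed; the \<open>(j + 1)\<close>-st copy of each such bit then costs at most \<open>log ((j + 1) / j)\<close>, which sums to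
  \<open>log n\<close> over all copies. The first copy and the \<open>O(n\<^sup>2)\<close> remaining bits are charged \<open>log (n\<^sup>5)\<close> each.
\<close>

subsection \<open>Greedy de Bruijn strings\<close>

lemma length_windows: "length (windows n x) = Suc (length x) - n"
  by (simp add: windows_def)

lemma distinct_windows_iff:
  "distinct (windows n x) \<longleftrightarrow> inj_on (\<lambda>i. take n (drop i x)) {..<Suc (length x) - n}"
  by (simp add: windows_def distinct_map atLeast0LessThan del: upt_Suc)

lemma windows_snoc:
  assumes "1 \<le> n" "n - 1 \<le> length x"
  shows "windows n (x @ [b]) = windows n x @ [drop (Suc (length x) - n) x @ [b]]"
proof -
  have "Suc (length (x @ [b])) - n = Suc (Suc (length x) - n)" using assms by auto
  moreover have "take n (drop i (x @ [b])) = take n (drop i x)" if "i < Suc (length x) - n" for i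
    using that by simp
  moreover have "take n (drop (Suc (length x) - n) (x @ [b])) = drop (Suc (length x) - n) x @ [b]"
    using assms by simp
  ultimately show ?thesis using assms by (simp add: windows_def del: drop_append take_append cong: map_cong)
qed

text \<open>Invariant of the run. The last clause keeps the trace of the preference for 0: a
  length-\<open>n\<close> window ends in 1 only if the same window ending in 0 starts at an earlier
  position.\<close>

definition greedy :: "nat \<Rightarrow> bool list \<Rightarrow> bool" where
  "greedy n x \<longleftrightarrow> prefix (replicate (n - 1) True) x \<and> distinct (windows n x) \<and>
     (\<forall>i. i + n \<le> length x \<longrightarrow> x ! (i + n - 1) \<longrightarrow>
        (\<exists>j<i. take n (drop j x) = take (n - 1) (drop i x) @ [False]))"

lemma greedy_length: "greedy n x \<Longrightarrow> n - 1 \<le> length x"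
  unfolding greedy_def by (metis length_replicate prefix_length_le)

lemma greedy_init: "1 \<le> n \<Longrightarrow> greedy n (replicate (n - 1) True)"
  by (auto simp: greedy_def windows_def)

text \<open>Only the window that ends in the new letter is new. If that letter is 1, then appending
  0 repeated a window, and this repeated window is the witness for the last clause of
  \<open>greedy\<close>.\<close>

lemma greedy_step:
  assumes n: "1 \<le> n" and g: "greedy n x" and s: "martin_step n x = Some y"
  shows "greedy n y \<and> length y = Suc (length x)"
proof -
  note len = greedy_length[OF g]
  obtain b where y: "y = x @ [b]" and d: "distinct (windows n y)"
    and b: "b \<Longrightarrow> \<not> distinct (windows n (x @ [False]))"
    using s by (auto simp: martin_step_def split: if_splits)
  have pr: "\<exists>j<i. take n (drop j y) = take (n - 1) (drop i y) @ [False]"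
    if i: "i + n \<le> length y" "y ! (i + n - 1)" for i
  proof (cases "i + n \<le> length x")
    case True
    then have "x ! (i + n - 1)" using i n by (simp add: y nth_append)
    then obtain j where "j < i" "take n (drop j x) = take (n - 1) (drop i x) @ [False]"
      using g True unfolding greedy_def by blast
    then show ?thesis using True by (intro exI[of _ j]) (simp add: y)
  next
    case False
    then have il: "i = Suc (length x) - n" using i by (simp add: y)
    then have "b" using i n len by (simp add: y nth_append)
    have "drop i x @ [False] \<in> set (windows n x)"
      using b[OF \<open>b\<close>] g by (simp add: windows_snoc[OF n len] greedy_def il)
    then obtain j where j: "j < Suc (length x) - n" "take n (drop j x) = drop i x @ [False]"
      by (auto simp: windows_def simp del: upt_Suc)
    then show ?thesis using il n len by (intro exI[of _ j]) (simp add: y)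
  qed
  have "prefix (replicate (n - 1) True) y" using g by (simp add: greedy_def y)
  then show ?thesis using d pr by (simp add: greedy_def) (simp add: y)
qed

lemma greedy_run:
  assumes "1 \<le> n" "greedy n x" "y = martin_run n k x"
  shows "greedy n y \<and> (martin_step n y = None \<or> length y = length x + k)"
  using assms(2,3)
proof (induction k arbitrary: x)
  case (Suc k)
  show ?case
  proof (cases "martin_step n x")
    case None
    then show ?thesis using Suc.prems by simp
  next
    case (Some z)
    then have "greedy n z" "length z = Suc (length x)"
      using greedy_step[OF assms(1) Suc.prems(1)] by auto
    then show ?thesis using Suc.IH[of z] Suc.prems(2) Some by auto
  qed
qed simp

lemma card_words: "card {w :: bool list. length w = n} = 2 ^ n"
  using card_lists_length_eq[of "UNIV :: bool set" n] by simp

lemma finite_words: "finite {w :: bool list. length w = n}"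
  using finite_lists_length_eq[of "UNIV :: bool set" n] by simp

lemma windows_words: "set (windows n x) \<subseteq> {w. length w = n}"
  by (auto simp: windows_def simp del: upt_Suc)

text \<open>At this length the distinct windows exhaust all \<open>2 ^ n\<close> words. Hence a run
  that spends its whole fuel is stuck as well, and \<open>stuck_full\<close> applies to either
  outcome of \<open>greedy_run\<close>.\<close>

lemma full_stuck:
  assumes n: "1 \<le> n" and g: "greedy n y" and len: "length y = n - 1 + 2 ^ n"
  shows "martin_step n y = None"
proof -
  have "card (set (windows n y)) = 2 ^ n"
    using g len n by (simp add: greedy_def distinct_card length_windows)
  then have "set (windows n y) = {w. length w = n}"
    using card_subset_eq[OF finite_words windows_words] by (simp add: card_words)
  then have "\<not> distinct (windows n (y @ [b]))" for b
    using n len by (simp add: windows_snoc)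
  then show ?thesis by (simp add: martin_step_def)
qed

text \<open>Once no bit can be appended, the last \<open>n - 1\<close> letters have been left twice, hence visited three
  times, hence start the string; so the walk in the de Bruijn graph is closed and balanced at every node.
  An unused edge \<open>a u\<close> then forces the edge \<open>u1\<close> to be unused, since \<open>1\<close> is only appended after \<open>0\<close> has been
  used; iterating, \<open>1\<^sup>n\<close> would be unused.\<close>
lemma stuck_full:
  assumes n: "1 \<le> n" and g: "greedy n x" and s: "martin_step n x = None"
  shows "set (windows n x) = {w. length w = n}"
    and "drop (Suc (length x) - n) x = replicate (n - 1) True"
proof -
  \<comment> \<open>The string is a walk in the de Bruijn graph: \<open>V i\<close> is the node
    reached after \<open>i\<close> edges, and \<open>W i\<close> is the edge from \<open>V i\<close>
    to \<open>V (Suc i)\<close>, for \<open>i < N\<close>.\<close>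
  define N where "N = Suc (length x) - n"
  define V where "V i = take (n - 1) (drop i x)" for i
  define W where "W i = take n (drop i x)" for i
  note len = greedy_length[OF g]
  have N: "length x = N + n - 1" using len n by (simp add: N_def)
  have setW: "set (windows n x) = W ` {..<N}"
    by (auto simp: windows_def W_def N_def simp del: upt_Suc)
  have inj: "inj_on W {..<N}"
    using g unfolding greedy_def distinct_windows_iff W_def N_def by blast
  have V0: "V 0 = replicate (n - 1) True"
    using g by (auto simp: greedy_def V_def prefix_def)
  have VN: "drop N x = V N" using n by (simp add: V_def N)
  have W_out: "W i = V i @ [x ! (i + n - 1)]" if "i < N" for i
    using that n N take_Suc_conv_app_nth[of "n - 1" "drop i x"] by (simp add: W_def V_def)
  have W_in: "W (i - 1) = x ! (i - 1) # V i" if "0 < i" "i \<le> N" for i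
  proof -
    have "drop (i - 1) x = x ! (i - 1) # drop i x"
      using that n N Cons_nth_drop_Suc[of "i - 1" x] by simp
    then show ?thesis using n by (cases n) (simp_all add: W_def V_def)
  qed
  have inW: "V N @ [b] \<in> W ` {..<N}" for b
  proof -
    have "\<not> distinct (windows n (x @ [b]))" for b
      using s by (cases b) (auto simp: martin_step_def split: if_splits)
    then have "drop N x @ [b] \<in> set (windows n x)"
      using g by (simp add: windows_snoc[OF n len] greedy_def N_def)
    then show ?thesis by (simp add: setW VN)
  qed
  define Out where "Out u = {i. i < N \<and> V i = u}" for u
  define In where "In u = {i. 0 < i \<and> i \<le> N \<and> V i = u}" for u
  have finO: "finite (Out u)" and finI: "finite (In u)" for u by (simp_all add: Out_def In_def)
  have In_inj: "inj_on (\<lambda>i. x ! (i - 1)) (In u)" for u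
  proof (rule inj_onI)
    fix i j assume ij: "i \<in> In u" "j \<in> In u" "x ! (i - 1) = x ! (j - 1)"
    then have "W (i - 1) = W (j - 1)" using W_in[of i] W_in[of j] by (simp add: In_def)
    moreover have "i - 1 < N" "j - 1 < N" using ij by (auto simp: In_def)
    ultimately have "i - 1 = j - 1" using inj by (auto dest: inj_onD)
    moreover have "0 < i" "0 < j" using ij by (auto simp: In_def)
    ultimately show "i = j" by simp
  qed
  have In2: "card (In u) \<le> 2" for u
    using card_inj_on_le[OF In_inj, of u UNIV] by simp
  have two_out: "2 \<le> card (Out u)" if u: "u @ [False] \<in> W ` {..<N}" "u @ [True] \<in> W ` {..<N}" for u
  proof -
    obtain i where i: "i < N" "W i = u @ [False]" using u(1) by auto
    obtain j where j: "j < N" "W j = u @ [True]" using u(2) by auto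
    have "i \<noteq> j" "{i, j} \<subseteq> Out u" using i j W_out[of i] W_out[of j] by (auto simp: Out_def)
    then show ?thesis using card_mono[OF finO, of "{i, j}" u] by simp
  qed
  have V0N: "V 0 = V N"
  proof (rule ccontr)
    assume "V 0 \<noteq> V N"
    then have "insert N (Out (V N)) \<subseteq> In (V N)"
      by (auto simp: Out_def In_def) (metis gr0I)+
    then have "card (insert N (Out (V N))) \<le> card (In (V N))" by (rule card_mono[OF finI])
    moreover have "card (insert N (Out (V N))) = Suc (card (Out (V N)))"
      using finO by (simp add: Out_def)
    ultimately show False using two_out[OF inW inW] In2[of "V N"] by simp
  qed
  have bal: "card (In u) = card (Out u)" for u
  proof -
    \<comment> \<open>The walk is closed, so identifying the final index \<open>N\<close> with the
      initial index 0 matches arrivals with departures.\<close>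
    have "bij_betw (\<lambda>i. if i = N then 0 else i) (In u) (Out u)"
      by (rule bij_betw_byWitness[where f' = "\<lambda>i. if i = 0 then N else i"])
        (auto simp: In_def Out_def V0N)
    then show ?thesis by (rule bij_betw_same_card)
  qed
  have shift: "u @ [True] \<notin> W ` {..<N}" if "a # u \<notin> W ` {..<N}" "length u = n - 1" for a u
  proof
    assume T: "u @ [True] \<in> W ` {..<N}"
    then obtain i where i: "i < N" "W i = u @ [True]" by auto
    then have "V i = u" "x ! (i + n - 1)" using W_out[of i] by auto
    moreover have "i + n \<le> length x" using i(1) n N by simp
    ultimately obtain j where "j < i" "W j = u @ [False]"
      using g unfolding greedy_def W_def V_def by blast
    then have "u @ [False] \<in> W ` {..<N}" using i(1) by (metis imageI lessThan_iff less_trans)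
    \<comment> \<open>Both edges out of \<open>u\<close> are used, so by balance both edges into
      \<open>u\<close> are used, including \<open>a # u\<close>.\<close>
    then have "2 \<le> card (In u)" using two_out T bal by simp
    moreover have "(\<lambda>i. x ! (i - 1)) ` In u \<subseteq> {\<not> a}"
    proof -
      have "x ! (i - 1) \<noteq> a" if "i \<in> In u" for i
      proof
        assume "x ! (i - 1) = a"
        then have "W (i - 1) = a # u" using W_in[of i] that by (simp add: In_def)
        moreover have "i - 1 < N" using that unfolding In_def by auto
        ultimately show False using \<open>a # u \<notin> W ` {..<N}\<close> by (metis imageI lessThan_iff)
      qed
      then show ?thesis by auto
    qed
    then have "card (In u) \<le> 1" using card_inj_on_le[OF In_inj, of u "{\<not> a}"] by simp
    ultimately show False by simp
  qed
  have "w \<in> W ` {..<N}" if "length w = n" for w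
  proof (rule ccontr)
    assume w: "w \<notin> W ` {..<N}"
    have "drop k w @ replicate k True \<notin> W ` {..<N}" if "k \<le> n" for k
      using that
    proof (induction k)
      case (Suc k)
      have "drop k w = w ! k # drop (Suc k) w"
        using Suc.prems \<open>length w = n\<close> by (simp add: Cons_nth_drop_Suc)
      then have "w ! k # (drop (Suc k) w @ replicate k True) \<notin> W ` {..<N}" using Suc by simp
      from shift[OF this] show ?case using Suc.prems \<open>length w = n\<close>
        by (simp add: replicate_append_same)
    qed (simp add: w)
    from this[of n] have "replicate n True \<notin> W ` {..<N}" using that by simp
    moreover have "replicate n True \<in> W ` {..<N}"
      using inW[of True] V0 V0N n by (cases n) (auto simp: replicate_append_same)
    ultimately show False by simp
  qed
  then show "set (windows n x) = {w. length w = n}" using windows_words[of n x] by (auto simp: setW)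
  show "drop (Suc (length x) - n) x = replicate (n - 1) True" using VN V0 V0N by (simp add: N_def)
qed

lemma martin_run_full:
  assumes n: "1 \<le> n" and x: "x = martin_run n (2 ^ n) (replicate (n - 1) True)"
  shows "greedy n x" "length x = n - 1 + 2 ^ n" "set (windows n x) = {w. length w = n}"
    "drop (2 ^ n) x = replicate (n - 1) True"
proof -
  have r: "greedy n x \<and> (martin_step n x = None \<or> length x = n - 1 + 2 ^ n)"
    using greedy_run[OF n greedy_init[OF n] x] by simp
  then show g: "greedy n x" by simp
  have "martin_step n x = None" using r full_stuck[OF n] by blast
  note st = stuck_full[OF n g this]
  show s: "set (windows n x) = {w. length w = n}" by (fact st)
  have "length (windows n x) = 2 ^ n"
    using g s distinct_card[of "windows n x"] by (simp add: greedy_def card_words)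
  then show len: "length x = n - 1 + 2 ^ n" using greedy_length[OF g] n by (simp add: length_windows)
  show "drop (2 ^ n) x = replicate (n - 1) True" using st(2) n by (simp add: len)
qed


subsection \<open>Shape of the de Bruijn strings\<close>

lemma length_db:
  assumes "1 \<le> n" shows "length (db n) = 2 ^ n"
  using martin_run_full(2)[OF assms refl] by (simp add: db_def)

lemma less_two_power_pred: "2 \<le> n \<Longrightarrow> 2 * n - 1 < (2::nat) ^ n"
  by (induction n rule: dec_induct) simp_all

text \<open>\<open>db n\<close> starts with 0^n 1 0^(n-2) 1. A zero is shown by refuting the earlier
  window that \<open>greedy\<close> demands before a 1; a one is shown because a 0 would repeat a
  window.\<close>

lemma db_nth:
  assumes n: "1 \<le> n" and p: "p < 2 * n" "p < 2 ^ n"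
  shows "db n ! p \<longleftrightarrow> p = n \<or> p = 2 * n - 1"
proof -
  define x where "x = martin_run n (2 ^ n) (replicate (n - 1) True)"
  note full = martin_run_full[OF n x_def]
  have len: "length x = n - 1 + 2 ^ n" by (fact full)
  have db: "db n ! q = x ! (n - 1 + q)" if "q < 2 ^ n" for q
    unfolding db_def x_def[symmetric] using that len by simp
  have x1: "x ! q" if "q < n - 1" for q
    using full(1) that by (auto simp: greedy_def prefix_def nth_append)
  have dist: "\<exists>k<n. x ! (i + k) \<noteq> x ! (j + k)" if "i < j" "j < 2 ^ n" for i j
  proof (rule ccontr)
    assume "\<not> ?thesis"
    then have "take n (drop i x) = take n (drop j x)"
      using that len n by (intro nth_equalityI) auto
    moreover have "inj_on (\<lambda>i. take n (drop i x)) {..<2 ^ n}"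
      using full(1) n unfolding greedy_def distinct_windows_iff len by simp
    ultimately show False using that inj_onD by fastforce
  qed
  have pref: "\<exists>j<i. \<not> x ! (j + n - 1) \<and> (\<forall>k<n - 1. x ! (j + k) = x ! (i + k))"
    if "i < 2 ^ n" "x ! (n - 1 + i)" for i
  proof -
    have "i + n \<le> length x" "x ! (i + n - 1)" using that n len by (auto simp: add.commute)
    then obtain j where j: "j < i" "take n (drop j x) = take (n - 1) (drop i x) @ [False]"
      using full(1) unfolding greedy_def by blast
    have "x ! (j + k) = (take (n - 1) (drop i x) @ [False]) ! k" if "k < n" for k
      using arg_cong[OF j(2), of "\<lambda>l. l ! k"] j(1) that len \<open>i + n \<le> length x\<close> by simp
    from this[of "n - 1"] this n j(1) \<open>i + n \<le> length x\<close> show ?thesis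
      by (intro exI[of _ j]) (auto simp: nth_append)
  qed
  \<comment> \<open>The window demanded at \<open>j < q\<close> would have to agree with the one at
    \<open>q\<close>. Where the latter has the first 0, at index \<open>n - 1\<close> of
    \<open>x\<close>, the former is still inside the initial ones.\<close>
  have z1: "\<not> x ! (n - 1 + q)" if "q < n" for q
    using that
  proof (induction q rule: less_induct)
    case (less q)
    show ?case
    proof
      assume a: "x ! (n - 1 + q)"
      have "q < 2 ^ n" using less.prems less_exp by (rule less_trans)
      then obtain j where j: "j < q" "\<not> x ! (j + n - 1)" "\<forall>k<n - 1. x ! (j + k) = x ! (q + k)"
        using pref a by blast
      have "x ! (j + (n - 1 - q)) = x ! (q + (n - 1 - q))"
        by (rule j(3)[rule_format]) (use j less.prems in linarith)
      moreover have "x ! (j + (n - 1 - q))" using x1 j less.prems by simp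
      moreover have "\<not> x ! (q + (n - 1 - q))" using less.IH[of 0] j less.prems by simp
      ultimately show False by simp
    qed
  qed
  \<comment> \<open>Otherwise the windows at \<open>n - 1\<close> and \<open>n\<close> would both be
    0^n.\<close>
  have o1: "x ! (n - 1 + n)"
  proof (rule ccontr)
    assume a: "\<not> ?thesis"
    obtain k where "k < n" "x ! (n - 1 + k) \<noteq> x ! (n + k)"
      using dist[of "n - 1" n] n less_exp[of n] by auto
    moreover have "\<not> x ! (n + k)"
      using z1[of "Suc k"] a n \<open>k < n\<close> by (cases "Suc k = n") auto
    ultimately show False using z1 by auto
  qed
  \<comment> \<open>The matching earlier window starts with 0, hence not in the initial ones, and
    must copy the 1 at index \<open>2 * n - 1\<close> to a smaller index. This index lies in the run
    of zeros given by \<open>z1\<close>.\<close>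
  have z2: "\<not> x ! (2 * n + q)" if "q < n - 2" for q
    using that
  proof (induction q rule: less_induct)
    case (less q)
    show ?case
    proof
      assume a: "x ! (2 * n + q)"
      have "n + 1 + q < 2 ^ n" using less.prems less_two_power_pred[of n] by linarith
      moreover have "x ! (n - 1 + (n + 1 + q))" using a n by (simp add: mult_2 add.assoc)
      ultimately obtain j where j: "j < n + 1 + q" "\<not> x ! (j + n - 1)"
        "\<forall>k<n - 1. x ! (j + k) = x ! (n + 1 + q + k)"
        using pref by blast
      have "x ! (j + (n - 2 - q)) = x ! (n + 1 + q + (n - 2 - q))"
        by (rule j(3)[rule_format]) (use j less.prems in linarith)
      also have "n + 1 + q + (n - 2 - q) = n - 1 + n" using less.prems by simp
      finally have t: "x ! (j + (n - 2 - q))" using o1 by simp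
      have "\<not> x ! j"
      proof -
        have "x ! j = x ! (n + 1 + q)" using j(3)[rule_format, of 0] less.prems by simp
        also have "n + 1 + q = n - 1 + (q + 2)" using n by simp
        finally have "x ! j = x ! (n - 1 + (q + 2))" .
        then show ?thesis using z1[of "q + 2"] less.prems by (metis less_diff_conv)
      qed
      then have "n - 1 \<le> j" using x1 by (meson not_le)
      moreover define i where "i = j + (n - 2 - q)"
      ultimately have "n - 1 \<le> i" "i < 2 * n - 1" using j less.prems by auto
      then have "\<not> x ! i" using z1[of "i - (n - 1)"] by simp
      then show False using t by (simp add: i_def)
    qed
  qed
  \<comment> \<open>Otherwise 1 0^(n-1) would be the window at \<open>n - 2\<close> and also the one
    at \<open>2 * n - 1\<close>.\<close>
  have o2: "x ! (3 * n - 2)" if n2: "2 \<le> n"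
  proof (rule ccontr)
    assume a: "\<not> ?thesis"
    have "n - 2 < 2 * n - 1" using n2 by linarith
    then obtain k where k: "k < n" "x ! (n - 2 + k) \<noteq> x ! (2 * n - 1 + k)"
      using dist less_two_power_pred[OF n2] by blast
    consider "k = 0" | "0 < k" "k < n - 1" | "k = n - 1" using k by linarith
    then show False
    proof cases
      case 1
      then show False using k x1[of "n - 2"] o1 n2 by (simp add: mult_2)
    next
      case 2
      then have "n - 2 + k = n - 1 + (k - 1)" "2 * n - 1 + k = 2 * n + (k - 1)"
        "k - 1 < n" "k - 1 < n - 2" using n2 by auto
      then show False using k(2) z1[of "k - 1"] z2[of "k - 1"] by metis
    next
      case 3
      then have "n - 2 + k = n - 1 + (n - 2)" "2 * n - 1 + k = 3 * n - 2" "n - 2 < n" using n2 by auto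
      then show False using k(2) z1[of "n - 2"] a by metis
    qed
  qed
  consider "p < n" | "p = n" | "n < p" "p < 2 * n - 1" | "n < p" "p = 2 * n - 1" using p by linarith
  then show ?thesis
  proof cases
    case 1
    then show ?thesis using db z1 p by auto
  next
    case 2
    then show ?thesis using db o1 p by simp
  next
    case 3
    have "n - 1 + p = 2 * n + (p - n - 1)" using 3 by simp
    then show ?thesis using db[of p] z2[of "p - n - 1"] 3 p by simp
  next
    case 4
    have "n - 1 + p = 3 * n - 2" using 4 by simp
    then show ?thesis using db[of p] o2 4 p by simp
  qed
qed

text \<open>The de Bruijn property. The padding with \<open>n - 1\<close> zeros plays the role of
  the cyclic continuation, since \<open>db n\<close> starts with zeros. Surjectivity is shown first;
  injectivity follows by counting.\<close>

lemma db_windows: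
  assumes n: "1 \<le> n"
  defines "W \<equiv> \<lambda>i. take n (drop i (db n @ replicate (n - 1) False))"
  shows "inj_on W {..<2 ^ n}" "W ` {..<2 ^ n} = {w. length w = n}"
proof -
  define x where "x = martin_run n (2 ^ n) (replicate (n - 1) True)"
  define m where "m = n - 1"
  note full = martin_run_full[OF n x_def]
  have len: "length x = m + 2 ^ n" using full by (simp add: m_def)
  have n_m: "n = Suc m" using n by (simp add: m_def)
  have mp: "n < 2 ^ n" by (rule less_exp)
  obtain D where x: "x = replicate m True @ D" using full(1) by (auto simp: greedy_def m_def prefix_def)
  have D: "db n = D" 
  proof -
    have "db n = drop m x" by (simp only: db_def x_def m_def)
    then show ?thesis by (simp add: x)
  qed
  have lD: "length D = 2 ^ n" using len x by simp
  have zero: "\<not> D ! q" if "q < n" for q using db_nth[OF n, of q] that mp by (simp add: D)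
  obtain E where E: "D = replicate m False @ E"
  proof
    show "D = replicate m False @ drop m D"
      using zero lD mp n_m by (intro nth_equalityI) (auto simp: nth_append)
  qed
  have WD: "W q = take n (drop q (D @ replicate m False))" for q by (simp only: W_def D m_def)
  have last: "drop (2 ^ n - m) D = replicate m True"
    using full(4) mp n_m by (simp add: x m_def[symmetric])
  text \<open>A window of \<open>1\<^bsup>n-1\<^esup> D\<close> starting in \<open>1\<^bsup>n-1\<^esup>\<close> also occurs at the end of \<open>D 0\<^bsup>n-1\<^esup>\<close>,
    because \<open>D\<close> ends in \<open>1\<^bsup>n-1\<^esup>\<close> and starts with \<open>0\<^bsup>n-1\<^esup>\<close>.\<close>
  have "w \<in> W ` {..<2 ^ n}" if "length w = n" for w
  proof -
    have "w \<in> set (windows n x)" using full(3) that by simp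
    then obtain i where i: "i < 2 ^ n" "w = take n (drop i x)"
      using len n_m by (auto simp: windows_def simp del: upt_Suc)
    show ?thesis
    proof (cases "m \<le> i")
      case True
      then have "w = W (i - m)" using i n_m by (simp add: WD x lD)
      then show ?thesis using i by auto
    next
      case False
      have "drop (2 ^ n - m + i) D = drop i (drop (2 ^ n - m) D)"
        by (simp only: drop_drop add.commute)
      also note last
      finally have "drop (2 ^ n - m + i) D = drop i (replicate m True)" .
      then have "W (2 ^ n - m + i) = take n (drop i (replicate m True) @ replicate m False)"
        using False mp n_m by (simp add: WD lD del: drop_replicate)
      then have "w = W (2 ^ n - m + i)" using i n_m False by (simp add: x E)
      moreover have "2 ^ n - m + i < 2 ^ n" using False mp n_m by simp
      ultimately show ?thesis by blast
    qed
  qed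
  moreover have lW: "length (W i) = n" if "i < 2 ^ n" for i
    using that n_m by (auto simp: WD lD)
  ultimately show "W ` {..<2 ^ n} = {w. length w = n}"
    using lW by auto
  then show "inj_on W {..<2 ^ n}"
    by (intro eq_card_imp_inj_on) (simp_all add: card_words)
qed

subsection \<open>The segments as sequences of de Bruijn blocks\<close>

lemma db_zeros:
  assumes "1 \<le> n" shows "prefix (replicate n False) (db n)"
proof -
  have "take n (db n) = replicate n False"
    using db_nth[OF assms] length_db[OF assms] less_trans[OF _ less_exp[of n]]
    by (intro nth_equalityI) (auto simp: less_imp_le[OF less_exp])
  then show ?thesis by (metis take_is_prefix)
qed

text \<open>Regroups the copies so that the end \<open>C\<close> of one joins the start
  \<open>A\<close> of the next. With zeros for \<open>A\<close> and \<open>C\<close>, the inner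
  copies become \<open>db n\<close>.\<close>

lemma concat_replicate_rotate:
  "concat (replicate (Suc t) (A @ E @ C)) = A @ E @ concat (replicate t ((C @ A) @ E)) @ C"
proof (induction t)
  case (Suc t)
  have "concat (replicate (Suc (Suc t)) (A @ E @ C)) = (A @ E @ C) @ concat (replicate (Suc t) (A @ E @ C))"
    by simp
  also note Suc
  finally show ?case by simp
qed simp

text \<open>Rotating by \<open>i \<le> n\<close> moves zeros from the front to the back, so the transition between two
  rotations only drops one zero from a copy of \<open>db n\<close>; the trailing zeros accumulate at the end.\<close>
lemma S_seg_blocks:
  assumes n: "1 \<le> n"
  obtains bs z where "S_seg n = concat (db n # bs) @ replicate z False" "z < n"
    "length bs = n - 1" "set bs \<subseteq> {db n, tl (db n)}"
proof -
  define s where "s = multiplicity (2::nat) n"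
  define t where "t = n div 2 ^ s"
  have dv: "2 ^ s dvd n" by (simp add: s_def multiplicity_dvd)
  then have nt: "n = 2 ^ s * t" by (simp add: t_def)
  then have "t \<noteq> 0" using n by (cases t) auto
  then obtain t' where t': "t = Suc t'" by (cases t) auto
  have sn: "2 ^ s \<le> n" using nt t' by simp
  obtain E where E: "db n = replicate n False @ E" using db_zeros[OF n] by (auto simp: prefix_def)
  have "tl (db n) = tl (replicate n False @ E)" by (simp only: E)
  also have "\<dots> = replicate (n - 1) False @ E" using n by (cases n) simp_all
  finally have tl: "tl (db n) = replicate (n - 1) False @ E" .
  have rot: "db_rot n i = replicate (n - i) False @ E @ replicate i False" if "i \<le> n" for i
    using that by (simp add: db_rot_def E)
  have db: "replicate i False @ replicate (n - i) False @ E = db n" if "i \<le> n" for i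
    using that by (simp add: E flip: replicate_add append_assoc)
  define R where "R i = concat (replicate t (db_rot n i))" for i
  have R: "R i = replicate (n - i) False @ E @ concat (replicate t' (db n)) @ replicate i False"
    if "i \<le> n" for i
    using that concat_replicate_rotate[of t' "replicate (n - i) False" E "replicate i False"]
    by (simp only: R_def t' rot append_assoc) (simp add: db append_assoc)
  have "\<exists>bs. concat (map R [0..<Suc m]) = concat (db n # bs) @ replicate m False \<and>
      length bs = Suc m * t - 1 \<and> set bs \<subseteq> {db n, tl (db n)}" if "m < 2 ^ s" for m
    using that
  proof (induction m)
    case 0
    show ?case using R[of 0] by (intro exI[of _ "replicate t' (db n)"]) (auto simp: t' E)
  next
    case (Suc m)
    then obtain bs where bs: "concat (map R [0..<Suc m]) = concat (db n # bs) @ replicate m False"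
      "length bs = Suc m * t - 1" "set bs \<subseteq> {db n, tl (db n)}"
      by auto
    have m: "Suc m \<le> n" "n = Suc (n - 1)" using Suc.prems sn n by auto
    have "concat (map R [0..<Suc (Suc m)]) = concat (map R [0..<Suc m]) @ R (Suc m)" by simp
    also have "\<dots> = concat (db n # bs) @ (replicate m False @ replicate (n - Suc m) False) @ E @
        concat (replicate t' (db n)) @ replicate (Suc m) False"
      using m by (simp only: bs R append_assoc)
    \<comment> \<open>The \<open>m\<close> zeros left over from the earlier rotations meet the
      \<open>n - Suc m\<close> leading zeros of the next one. One zero is missing, so this copy is
      \<open>tl (db n)\<close>.\<close>
    also have "replicate m False @ replicate (n - Suc m) False = replicate (n - 1) False"
      using m by (simp flip: replicate_add)
    also have "concat (db n # bs) @ replicate (n - 1) False @ E @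
        concat (replicate t' (db n)) @ replicate (Suc m) False =
        concat (db n # (bs @ tl (db n) # replicate t' (db n))) @ replicate (Suc m) False"
      by (simp add: tl)
    finally show ?case using bs
      by (intro exI[of _ "bs @ tl (db n) # replicate t' (db n)"]) (auto simp: t')
  qed
  from this[of "2 ^ s - 1"] obtain bs where
    "concat (map R [0..<2 ^ s]) = concat (db n # bs) @ replicate (2 ^ s - 1) False"
    "length bs = 2 ^ s * t - 1" "set bs \<subseteq> {db n, tl (db n)}"
    by auto
  moreover have "S_seg n = concat (map R [0..<2 ^ s])"
    by (simp add: S_seg_def R_def[abs_def] s_def t_def Let_def)
  moreover have "(2::nat) ^ s - 1 < n" using sn n by simp
  ultimately show ?thesis using nt that by metis
qed

subsection \<open>Occurrences\<close>

lemma prefix_iff_take: "prefix w y \<longleftrightarrow> length w \<le> length y \<and> take (length w) y = w"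
  by (auto simp: prefix_def)
     (metis append_take_drop_id)

lemma occ_altdef: "occ w x = card {i. i \<le> length x \<and> prefix w (drop i x)}"
proof -
  have "set (filter (\<lambda>i. take (length w) (drop i x) = w) [0..<Suc (length x) - length w]) =
      {i. i \<le> length x \<and> prefix w (drop i x)}"
    by (auto simp: prefix_iff_take simp del: upt_Suc)
  then show ?thesis unfolding occ_def
    by (metis distinct_card distinct_filter distinct_upt)
qed

lemma occ_altdef_ne:
  "w \<noteq> [] \<Longrightarrow> occ w x = card {i. i < length x \<and> prefix w (drop i x)}"
  unfolding occ_altdef by (rule arg_cong[where f = card]) (auto simp: nat_less_le)

lemma occ_pos_iff: "0 < occ w x \<longleftrightarrow> sublist w x"
proof -
  have "(\<exists>i\<le>length x. prefix w (drop i x)) \<longleftrightarrow> sublist w x"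
  proof
    assume "\<exists>i\<le>length x. prefix w (drop i x)"
    then obtain i r where "drop i x = w @ r" by (auto simp: prefix_def)
    then have "x = take i x @ w @ r" by (metis append_take_drop_id)
    then show "sublist w x" unfolding sublist_def by blast
  next
    assume "sublist w x"
    then obtain u v where "x = u @ w @ v" by (auto simp: sublist_def)
    then show "\<exists>i\<le>length x. prefix w (drop i x)" by (intro exI[of _ "length u"]) simp
  qed
  then show ?thesis by (simp add: occ_altdef card_gt_0_iff)
qed

lemma occ_mono_prefix:
  assumes "prefix x y" shows "occ w x \<le> occ w y"
  unfolding occ_altdef using assms by (intro card_mono) (auto simp: prefix_def)

lemma occ_append_ge: "w \<noteq> [] \<Longrightarrow> occ w u + occ w v \<le> occ w (u @ v)"
proof -
  assume w: "w \<noteq> []"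
  have "occ w u + occ w v = card {i. i < length u \<and> prefix w (drop i u)} +
      card ((+) (length u) ` {i. i < length v \<and> prefix w (drop i v)})"
    using w by (simp add: occ_altdef_ne card_image)
  also have "\<dots> = card ({i. i < length u \<and> prefix w (drop i u)} \<union>
      (+) (length u) ` {i. i < length v \<and> prefix w (drop i v)})"
    by (rule card_Un_disjoint[symmetric]) auto
  also have "\<dots> \<le> card {i. i < length (u @ v) \<and> prefix w (drop i (u @ v))}"
    by (rule card_mono) auto
  finally show ?thesis using w by (simp add: occ_altdef_ne)
qed

text \<open>Each occurrence is charged to the part in which it starts; those starting in
  \<open>u\<close> may run into \<open>v\<close>.\<close>

lemma occ_append_le:
  "w \<noteq> [] \<Longrightarrow> occ w (u @ v) \<le> card {i. i < length u \<and> prefix w (drop i (u @ v))} + occ w v"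
proof -
  assume w: "w \<noteq> []"
  have "{i. i < length (u @ v) \<and> prefix w (drop i (u @ v))} \<subseteq>
      {i. i < length u \<and> prefix w (drop i (u @ v))} \<union>
      (+) (length u) ` {i. i < length v \<and> prefix w (drop i v)}"
  proof
    fix i assume i: "i \<in> {i. i < length (u @ v) \<and> prefix w (drop i (u @ v))}"
    show "i \<in> {i. i < length u \<and> prefix w (drop i (u @ v))} \<union>
      (+) (length u) ` {i. i < length v \<and> prefix w (drop i v)}"
    proof (cases "i < length u")
      case False
      then have "i = length u + (i - length u)" by simp
      then show ?thesis using i False by (intro UnI2 rev_image_eqI[of "i - length u"]) auto
    qed (use i in auto)
  qed
  then have "occ w (u @ v) \<le> card ({i. i < length u \<and> prefix w (drop i (u @ v))} \<union>
      (+) (length u) ` {i. i < length v \<and> prefix w (drop i v)})"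
    unfolding occ_altdef_ne[OF w] by (rule card_mono[rotated]) simp
  also have "\<dots> \<le> card {i. i < length u \<and> prefix w (drop i (u @ v))} + occ w v"
    unfolding occ_altdef_ne[OF w] by (rule order.trans[OF card_Un_le]) (simp add: card_image)
  finally show ?thesis .
qed

text \<open>Used to get two occurrences of a context from its two different continuations.\<close>

lemma occ_snoc_sum: "occ (c @ [False]) x + occ (c @ [True]) x \<le> occ c x"
proof -
  have "occ (c @ [False]) x + occ (c @ [True]) x =
    card ({i. i \<le> length x \<and> prefix (c @ [False]) (drop i x)} \<union>
      {i. i \<le> length x \<and> prefix (c @ [True]) (drop i x)})"
    unfolding occ_altdef by (rule card_Un_disjoint[symmetric]) (auto simp: prefix_def)
  also have "\<dots> \<le> occ c x"
    unfolding occ_altdef by (rule card_mono) (auto dest: append_prefixD)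
  finally show ?thesis .
qed

lemma sublist_snoc_butlast: "sublist (c @ [b]) x \<Longrightarrow> sublist c (butlast x)"
  unfolding sublist_def by (metis append.assoc append_Cons append_Nil butlast_append list.discI)

subsection \<open>Windows in the sequence\<close>

lemma prefix_take_eq: "prefix w y \<Longrightarrow> m \<le> length w \<Longrightarrow> take m y = take m w"
  by (auto simp: prefix_def)

lemma db_ne: "1 \<le> n \<Longrightarrow> db n \<noteq> []"
  using length_db[of n] by auto

lemma drop_tl_db: "1 \<le> n \<Longrightarrow> drop i (tl (db n) @ v) = drop (Suc i) (db n @ v)"
  using db_ne[of n] by (cases "db n") auto

lemma db_zeros_pred: "1 \<le> n \<Longrightarrow> prefix (replicate (n - 1) False) (db n)"
  using db_zeros[of n] by (cases n) (auto simp: prefix_def simp flip: replicate_append_same)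

lemma tl_db_zeros: "1 \<le> n \<Longrightarrow> prefix (replicate (n - 1) False) (tl (db n))"
  using db_zeros[of n] by (cases n) (auto simp: prefix_def)

lemma block_zeros:
  "1 \<le> n \<Longrightarrow> u \<in> {db n, tl (db n)} \<Longrightarrow> prefix (replicate (n - 1) False) u"
  using db_zeros_pred tl_db_zeros by auto

lemma concat_blocks_zeros:
  assumes "1 \<le> n" "set bs \<subseteq> {db n, tl (db n)}" "prefix (replicate (n - 1) False) v"
  shows "prefix (replicate (n - 1) False) (concat bs @ v)"
  using assms block_zeros[OF assms(1)] by (cases bs) (auto intro: prefix_prefix)

lemma zeros_prefix_zeros:
  assumes "prefix (replicate m False) v" shows "prefix (replicate m False) (replicate z False @ v)"
proof (induction z)
  case (Suc z)
  then obtain r where "replicate z False @ v = replicate m False @ r" by (auto simp: prefix_def)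
  then have "replicate (Suc z) False @ v = replicate m False @ False # r"
    by (simp add: replicate_app_Cons_same)
  then show ?case by (metis prefixI)
qed (use assms in simp)

text \<open>A window starting in a block reaches at most \<open>n - 1\<close> letters beyond it, and
  these are zeros. So \<open>db_windows\<close> applies inside the long sequence.\<close>

lemma block_window:
  assumes "1 \<le> n" "prefix (replicate (n - 1) False) v" "i < 2 ^ n"
  shows "take n (drop i (db n @ v)) = take n (drop i (db n @ replicate (n - 1) False))"
proof -
  obtain r where "v = replicate (n - 1) False @ r" using assms(2) by (auto simp: prefix_def)
  then show ?thesis using assms(1,3) by (simp add: length_db)
qed

lemma block_window_inj:
  assumes "1 \<le> n" "prefix (replicate (n - 1) False) v" "i < 2 ^ n" "j < 2 ^ n"
    "take n (drop i (db n @ v)) = take n (drop j (db n @ v))"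
  shows "i = j"
  using assms(5) inj_onD[OF db_windows(1)[OF assms(1)], of i j] assms(3,4)
  by (simp only: block_window[OF assms(1,2)] lessThan_iff)

text \<open>An occurrence of \<open>w\<close> fixes the first \<open>n - 1\<close> letters of the
  window at its start. Only two windows extend them, and each starts at most once in a
  block.\<close>

lemma block_count:
  assumes n: "1 \<le> n" and v: "prefix (replicate (n - 1) False) v" and w: "n - 1 \<le> length w"
    and u: "u \<in> {db n, tl (db n)}"
  shows "card {i. i < length u \<and> prefix w (drop i (u @ v))} \<le> 2"
proof -
  define I where "I = {i. i < length (db n) \<and> prefix w (drop i (db n @ v))}"
  have "card I \<le> card ((\<lambda>b. take (n - 1) w @ [b]) ` (UNIV :: bool set))"
  proof (rule card_inj_on_le[where f = "\<lambda>i. take n (drop i (db n @ v))"])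
    show "inj_on (\<lambda>i. take n (drop i (db n @ v))) I"
      by (rule inj_onI) (auto simp: I_def length_db[OF n] intro: block_window_inj[OF n v])
    show "(\<lambda>i. take n (drop i (db n @ v))) ` I \<subseteq> range (\<lambda>b. take (n - 1) w @ [b])"
    proof safe
      fix i assume i: "i \<in> I"
      define y where "y = drop i (db n @ v)"
      have "n - 1 \<le> length v" using prefix_length_le[OF v] by simp
      then have "n - 1 < length y" using i n by (auto simp: I_def y_def)
      then have "take n y = take (n - 1) y @ [y ! (n - 1)]"
        using take_Suc_conv_app_nth[of "n - 1" y] n by simp
      moreover have "take (n - 1) y = take (n - 1) w"
        using i w by (intro prefix_take_eq) (auto simp: I_def y_def)
      ultimately show "take n (drop i (db n @ v)) \<in> range (\<lambda>b. take (n - 1) w @ [b])"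
        by (simp add: y_def)
    qed
  qed simp
  also have "\<dots> \<le> card (UNIV :: bool set)" by (rule card_image_le) simp
  finally have I: "card I \<le> 2" by simp
  show ?thesis
  proof (cases "u = db n")
    case False
    then have u': "u = tl (db n)" using u by simp
    have "Suc ` {i. i < length u \<and> prefix w (drop i (u @ v))} \<subseteq> I"
      unfolding u' drop_tl_db[OF n] I_def by auto
    then have "card (Suc ` {i. i < length u \<and> prefix w (drop i (u @ v))}) \<le> card I"
      by (rule card_mono[rotated]) (simp add: I_def)
    then show ?thesis using I by (simp add: card_image)
  qed (use I I_def in simp)
qed

lemma occ_blocks:
  assumes n: "1 \<le> n" and w: "n - 1 \<le> length w" "w \<noteq> []"
    and v: "prefix (replicate (n - 1) False) v" and bs: "set bs \<subseteq> {db n, tl (db n)}"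
  shows "occ w (concat bs @ v) \<le> 2 * length bs + occ w v"
  using bs
proof (induction bs)
  case (Cons u bs)
  have "card {i. i < length u \<and> prefix w (drop i (u @ (concat bs @ v)))} \<le> 2"
    using Cons.prems by (intro block_count[OF n _ w(1)] concat_blocks_zeros[OF n _ v]) auto
  then show ?case using Cons occ_append_le[OF w(2), of u "concat bs @ v"] by simp
qed simp

lemma occ_zeros:
  assumes "w \<noteq> []" shows "occ w (replicate z False @ v) \<le> z + occ w v"
proof -
  have "card {i. i < length (replicate z False) \<and> prefix w (drop i (replicate z False @ v))} \<le> card {..<z}"
    by (rule card_mono) auto
  then show ?thesis using occ_append_le[OF assms, of "replicate z False" v] by simp
qed

text \<open>Two occurrences for each of the \<open>n\<close> blocks, plus at most one for each of
  the fewer than \<open>n\<close> trailing zeros.\<close>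

lemma occ_seg:
  assumes n: "1 \<le> n" and w: "n - 1 \<le> length w" "w \<noteq> []"
    and v: "prefix (replicate (n - 1) False) v"
  shows "occ w (S_seg n @ v) \<le> 3 * n + occ w v"
proof -
  obtain bs z where S: "S_seg n = concat (db n # bs) @ replicate z False" "z < n"
    "length bs = n - 1" "set bs \<subseteq> {db n, tl (db n)}"
    by (rule S_seg_blocks[OF n])
  have "occ w (concat (db n # bs) @ (replicate z False @ v)) \<le>
      2 * length (db n # bs) + occ w (replicate z False @ v)"
    using S by (intro occ_blocks[OF n w] zeros_prefix_zeros v) auto
  then show ?thesis using S occ_zeros[OF w(2), of z v] n by simp
qed

text \<open>Zeros are appended so that every block, also the last one, is followed by \<open>n - 1\<close> zeros.\<close>
definition S_tail :: "nat \<Rightarrow> nat \<Rightarrow> bool list" where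
  "S_tail n k = concat (map S_seg [k..<Suc n]) @ replicate n False"

lemma S_tail_rec: "k \<le> n \<Longrightarrow> S_tail n k = S_seg k @ S_tail n (Suc k)"
  by (simp add: S_tail_def upt_conv_Cons del: upt_Suc)

lemma S_tail_end: "S_tail n (Suc n) = replicate n False"
  by (simp add: S_tail_def)

lemma S_tail_1: "1 \<le> n \<Longrightarrow> S_tail n 1 = S_prefix n @ S_seg n @ replicate n False"
  by (simp add: S_tail_def S_prefix_def)

lemma db_prefix_S_tail:
  assumes "1 \<le> k" "k \<le> n" shows "prefix (db k) (S_tail n k)"
  by (rule S_seg_blocks[OF assms(1)]) (simp add: S_tail_rec[OF assms(2)])

lemma S_tail_zeros:
  assumes "1 \<le> k" "k \<le> Suc n" shows "prefix (replicate (k - 1) False) (S_tail n k)"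
proof (cases "k = Suc n")
  case False
  then show ?thesis using db_prefix_S_tail[of k n] db_zeros_pred[of k] assms
    by (auto intro: prefix_order.trans)
qed (simp add: S_tail_end)

text \<open>The source of the quadratic count: for \<open>k = 1\<close> a word of length at least
  \<open>n - 1\<close> occurs at most \<open>3 * n * n + n\<close> times. It is long enough for
  \<open>occ_seg\<close> in every earlier segment too.\<close>

lemma occ_S_tail:
  assumes w: "n - 1 \<le> length w" "w \<noteq> []" and k: "1 \<le> k" "k \<le> Suc n"
  shows "occ w (S_tail n k) \<le> 3 * n * (Suc n - k) + n"
  using k(2,1)
proof (induction k rule: inc_induct)
  case base
  then show ?case using occ_zeros[OF w(2), of n "[]"] w(2) by (simp add: S_tail_end occ_altdef_ne)
next
  case (step k)
  have "prefix (replicate (k - 1) False) (S_tail n (Suc k))"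
    using S_tail_zeros[of "Suc k" n] step
    by (cases k) (auto simp: prefix_def simp flip: replicate_append_same)
  then have "occ w (S_seg k @ S_tail n (Suc k)) \<le> 3 * k + occ w (S_tail n (Suc k))"
    using step w by (intro occ_seg) auto
  also have "\<dots> \<le> 3 * n + (3 * n * (Suc n - Suc k) + n)" using step by simp
  also have "\<dots> = 3 * n * (Suc n - k) + n" using step by (simp add: Suc_diff_le)
  finally show ?case using step by (simp add: S_tail_rec)
qed

text \<open>Pad \<open>w\<close> with zeros to length \<open>n\<close> and find it among the windows
  of \<open>db n\<close>. For \<open>n\<close> at least 2 a second block follows the first and
  supplies the \<open>n - 1\<close> zeros of the padding.\<close>

lemma sublist_S_seg:
  assumes n: "2 \<le> n" and w: "length w \<le> n"
  shows "sublist w (S_seg n)"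
proof -
  have n1: "1 \<le> n" using n by simp
  obtain bs z where S: "S_seg n = concat (db n # bs) @ replicate z False"
    "length bs = n - 1" "set bs \<subseteq> {db n, tl (db n)}"
    by (rule S_seg_blocks[OF n1])
  obtain u bs' where bs: "bs = u # bs'" using S(2) n by (cases bs) auto
  then have "prefix (replicate (n - 1) False) u" using S block_zeros[OF n1] by simp
  then obtain r where "S_seg n = (db n @ replicate (n - 1) False) @ r"
    by (auto simp: S bs prefix_def)
  moreover have "w @ replicate (n - length w) False \<in> {w. length w = n}" using w by simp
  then obtain i where "w @ replicate (n - length w) False =
      take n (drop i (db n @ replicate (n - 1) False))"
    unfolding db_windows(2)[OF n1, symmetric] by blast
  then have "sublist (w @ replicate (n - length w) False) (db n @ replicate (n - 1) False)"
    by (metis sublist_take sublist_drop sublist_order.order_trans)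
  ultimately show ?thesis
    by (metis sublist_append_rightI sublist_order.order_trans)
qed

lemma sublist_S_prefix:
  assumes "3 \<le> n" "length w \<le> n - 1" shows "sublist w (S_prefix n)"
proof -
  have "[1..<n] = [1..<n - 1] @ [n - 1]" using assms upt_Suc_append[of 1 "n - 1"] by simp
  then have "S_prefix n = concat (map S_seg [1..<n - 1]) @ S_seg (n - 1)" by (simp add: S_prefix_def)
  moreover have "sublist w (S_seg (n - 1))" using assms by (intro sublist_S_seg) auto
  ultimately show ?thesis by (metis sublist_append_leftI sublist_order.order_trans)
qed

section \<open>Uniqueness of the anchor word\<close>

text \<open>\<open>anchored n y\<close>: in \<open>y\<close>, the word \<open>0\<^bsup>n-1\<^esup> 1 0\<^bsup>n-2\<^esup> 1\<close>
  only occurs at the start of a copy of \<open>tl (db n)\<close>.\<close>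
definition anchored :: "nat \<Rightarrow> bool list \<Rightarrow> bool" where
  "anchored n y \<longleftrightarrow>
     (\<forall>i. prefix (take (2 * n - 1) (tl (db n))) (drop i y) \<longrightarrow> prefix (tl (db n)) (drop i y))"

lemma anchor_nth:
  assumes "2 \<le> n" "j < 2 * n - 1"
  shows "take (2 * n - 1) (tl (db n)) ! j \<longleftrightarrow> j = n - 1 \<or> j = 2 * n - 2"
  using assms db_nth[of n "Suc j"] less_two_power_pred[of n] length_db[of n]
  by (auto simp: nth_tl)

lemma length_anchor: "2 \<le> n \<Longrightarrow> length (take (2 * n - 1) (tl (db n))) = 2 * n - 1"
  using less_two_power_pred[of n] length_db[of n] by simp

lemma anchor_prefix_nth:
  assumes "2 \<le> n" "prefix (take (2 * n - 1) (tl (db n))) y" "j < 2 * n - 1"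
  shows "y ! j \<longleftrightarrow> j = n - 1 \<or> j = 2 * n - 2"
  using assms(2) anchor_nth[OF assms(1,3)] length_anchor[OF assms(1)] assms(3)
  by (auto simp: prefix_def nth_append simp del: length_take)

lemma anchored_append:
  assumes "\<And>i. i < length u \<Longrightarrow> prefix (take (2 * n - 1) (tl (db n))) (drop i (u @ v)) \<Longrightarrow>
      prefix (tl (db n)) (drop i (u @ v))"
    and "anchored n v"
  shows "anchored n (u @ v)"
  unfolding anchored_def
proof (intro allI impI)
  fix i assume "prefix (take (2 * n - 1) (tl (db n))) (drop i (u @ v))"
  then show "prefix (tl (db n)) (drop i (u @ v))"
    using assms by (cases "i < length u") (auto simp: anchored_def)
qed

lemma anchored_zeros:
  assumes "2 \<le> n" shows "anchored n (replicate z False)"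
  unfolding anchored_def
proof (intro allI impI)
  fix i assume a: "prefix (take (2 * n - 1) (tl (db n))) (drop i (replicate z False))"
  then have "2 * n - 1 \<le> z - i" using prefix_length_le[OF a] length_anchor[OF assms] by simp
  then show "prefix (tl (db n)) (drop i (replicate z False))"
    using anchor_prefix_nth[OF assms a, of "n - 1"] assms by (simp add: less_diff_conv2)
qed

text \<open>Reduces the claim to start positions in a single copy of \<open>db k\<close> followed by
  zeros. Positions in \<open>tl (db k)\<close> are those in \<open>db k\<close> shifted by
  one.\<close>

lemma anchored_blocks:
  assumes k: "1 \<le> k" and bs: "set bs \<subseteq> {db k, tl (db k)}"
    and v: "prefix (replicate (k - 1) False) v" "anchored n v"
    and start: "\<And>i r. i < 2 ^ k \<Longrightarrow> prefix (replicate (k - 1) False) r \<Longrightarrow>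
      prefix (take (2 * n - 1) (tl (db n))) (drop i (db k @ r)) \<Longrightarrow>
      prefix (tl (db n)) (drop i (db k @ r))"
  shows "anchored n (concat bs @ v)"
  using bs
proof (induction bs)
  case (Cons u bs)
  have r: "prefix (replicate (k - 1) False) (concat bs @ v)"
    using Cons.prems by (intro concat_blocks_zeros[OF k _ v(1)]) auto
  have "anchored n (u @ (concat bs @ v))"
  proof (rule anchored_append)
    fix i assume i: "i < length u"
      "prefix (take (2 * n - 1) (tl (db n))) (drop i (u @ (concat bs @ v)))"
    show "prefix (tl (db n)) (drop i (u @ (concat bs @ v)))"
    proof (cases "u = db k")
      case True
      then show ?thesis using start[OF _ r] i k by (simp add: length_db)
    next
      case False
      then have u: "u = tl (db k)" using Cons.prems by simp
      show ?thesis using start[OF _ r, of "Suc i"] i k unfolding u drop_tl_db[OF k]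
        by (simp add: length_db)
    qed
  qed (use Cons in auto)
  then show ?case by simp
qed (use v in simp)

text \<open>The first \<open>n\<close> letters of the anchor form the window at position 1 of
  \<open>db n\<close>, and windows do not repeat in a block.\<close>

lemma anchored_S_seg:
  assumes n: "2 \<le> n" shows "anchored n (S_seg n @ replicate n False)"
proof -
  have n1: "1 \<le> n" using n by simp
  obtain bs z where S: "S_seg n = concat (db n # bs) @ replicate z False"
    "set bs \<subseteq> {db n, tl (db n)}"
    by (rule S_seg_blocks[OF n1])
  have "anchored n (concat (db n # bs) @ (replicate z False @ replicate n False))"
  proof (rule anchored_blocks[OF n1])
    show "anchored n (replicate z False @ replicate n False)"
      using anchored_zeros[OF n, of "z + n"] by (simp add: replicate_add)
    show "prefix (replicate (n - 1) False) (replicate z False @ replicate n False)"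
      using n1 by (intro zeros_prefix_zeros) (cases n, auto simp flip: replicate_append_same)
    fix i r assume i: "i < 2 ^ n" and r: "prefix (replicate (n - 1) False) r"
      and p: "prefix (take (2 * n - 1) (tl (db n))) (drop i (db n @ r))"
    have "take n (drop i (db n @ r)) = take n (take (2 * n - 1) (tl (db n)))"
      using n length_anchor[OF n] by (intro prefix_take_eq[OF p]) simp
    also have "\<dots> = take n (tl (db n))"
      using n by (simp only: take_take) (simp add: min_absorb1)
    also have "\<dots> = take n (drop 1 (db n @ r))"
      using less_two_power_pred[OF n] n length_db[OF n1] db_ne[OF n1]
      by (simp add: drop_Suc)
    finally have eq: "take n (drop i (db n @ r)) = take n (drop 1 (db n @ r))" .
    have one: "1 < (2::nat) ^ n" using n less_exp[of n] by linarith
    have "i = 1"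
      using i one by (rule block_window_inj[OF n1 r _ _ eq])
    then show "prefix (tl (db n)) (drop i (db n @ r))"
      using db_ne[OF n1] by (simp add: drop_Suc)
  qed (use S in auto)
  then show ?thesis using S by simp
qed

text \<open>For \<open>k < n\<close> the anchor cannot start in \<open>S_seg k\<close> at all: its
  ones are \<open>n - 1\<close> apart, whereas the first two ones met from there have the wrong
  distance or come too late.\<close>

lemma anchored_S_tail:
  assumes n: "3 \<le> n" and k: "1 \<le> k" "k \<le> n"
  shows "anchored n (S_tail n k)"
  using k(2,1)
proof (induction k rule: inc_induct)
  case base
  show ?case using anchored_S_seg[of n] n by (simp add: S_tail_rec S_tail_end)
next
  case (step k)
  note k = \<open>1 \<le> k\<close>
  have n2: "2 \<le> n" using n by simp
  obtain bs z where S: "S_seg k = concat (db k # bs) @ replicate z False" "z < k"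
    "set bs \<subseteq> {db k, tl (db k)}"
    by (rule S_seg_blocks[OF k])
  define v where "v = S_tail n (Suc k)"
  have v: "anchored n v" using step by (simp add: v_def)
  have "prefix (replicate k False) v" using S_tail_zeros[of "Suc k" n] step by (simp add: v_def)
  then have vz: "prefix (replicate (k - 1) False) v"
    using k by (cases k) (auto simp: prefix_def simp flip: replicate_append_same)
  obtain r0 where v_db: "v = db (Suc k) @ r0"
    using db_prefix_S_tail[of "Suc k" n] step by (auto simp: v_def prefix_def)
  have v_nth: "v ! j \<longleftrightarrow> j = Suc k \<or> j = 2 * k + 1" if "j \<le> 2 * k + 1" for j
    using that db_nth[of "Suc k" j] less_two_power_pred[of "Suc k"] k length_db[of "Suc k"]
    by (simp add: v_db nth_append)
  have "anchored n (concat (db k # bs) @ (replicate z False @ v))"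
  proof (rule anchored_blocks[OF k])
    show "anchored n (replicate z False @ v)"
    proof (rule anchored_append[OF _ v])
      fix i assume i: "i < length (replicate z False)"
        and p: "prefix (take (2 * n - 1) (tl (db n))) (drop i (replicate z False @ v))"
      \<comment> \<open>Counted from \<open>i\<close>, the ones at \<open>Suc k\<close> and
        \<open>2 * k + 1\<close> of \<open>db (Suc k)\<close> appear at \<open>a\<close> and
        \<open>a + k\<close>. Matching the anchor forces \<open>a = n - 1\<close>, hence
        \<open>k < n - 1\<close>, and the second one comes too early.\<close>
      define a where "a = z - i + Suc k"
      have y: "(replicate (z - i) False @ v) ! j \<longleftrightarrow> j = n - 1 \<or> j = 2 * n - 2"
        if "j < 2 * n - 1" for j
        using anchor_prefix_nth[OF n2 p that] i by simp
      have y': "(replicate (z - i) False @ v) ! j \<longleftrightarrow> j = a \<or> j = a + k" if "j \<le> a + k" for j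
        using that v_nth[of "j - (z - i)"] by (auto simp: a_def nth_append)
      have "a = n - 1"
      proof (rule linorder_cases[of a "n - 1"])
        assume "a < n - 1"
        then have "a < 2 * n - 1" "a \<noteq> n - 1" "a \<noteq> 2 * n - 2" by linarith+
        then show ?thesis using y[of a] y'[of a] by simp
      next
        assume "n - 1 < a"
        then show ?thesis using y[of "n - 1"] y'[of "n - 1"] n by auto
      qed
      moreover have "k < n - 1" using i calculation by (simp add: a_def)
      ultimately have False using y[of "a + k"] y'[of "a + k"] n k by auto
      then show "prefix (tl (db n)) (drop i (replicate z False @ v))" ..
    qed
    fix i r assume i: "i < 2 ^ k" and r: "prefix (replicate (k - 1) False) r"
      and p: "prefix (take (2 * n - 1) (tl (db n))) (drop i (db k @ r))"
    have kn: "k \<le> n - 1" using step by simp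
    define y where "y = drop i (db k @ r)"
    have yn: "y ! j \<longleftrightarrow> j = n - 1 \<or> j = 2 * n - 2" if "j < 2 * n - 1" for j
      unfolding y_def by (rule anchor_prefix_nth[OF n2 p that])
    have ly: "2 * n - 1 \<le> length y"
      using prefix_length_le[OF p] length_anchor[OF n2] by (simp add: y_def)
    \<comment> \<open>The anchor starts with \<open>n - 1 \<ge> k\<close> zeros, which by uniqueness
      of windows are those at the start of \<open>db k\<close>. The ones of \<open>db k\<close> are
      then only \<open>k - 1\<close> apart.\<close>
    have "take k y = replicate k False"
      using yn ly kn n by (intro nth_equalityI) auto
    also have "\<dots> = take k (drop 0 (db k @ r))"
      using db_zeros[OF k] by (auto simp: prefix_def)
    finally have "i = 0" unfolding y_def using i by (intro block_window_inj[OF k r]) auto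
    then have D: "y ! j \<longleftrightarrow> j = k \<or> j = 2 * k - 1" if "j < 2 * k" "j < 2 ^ k" for j
      using that db_nth[OF k that] length_db[OF k] by (simp add: y_def nth_append)
    have "k = n - 1" using D[of k] yn[of k] kn k less_exp[of k] n by auto
    then have False using D[of "2 * k - 1"] yn[of "2 * k - 1"] less_two_power_pred[of k] n by auto
    then show "prefix (tl (db n)) (drop i (db k @ r))" ..
  qed (use S zeros_prefix_zeros[OF vz] in auto)
  then show ?case using S step by (simp add: S_tail_rec v_def)
qed

subsection \<open>Cost of encoding one bit\<close>

lemma freq_pos_iff: "0 < freq x c b \<longleftrightarrow> sublist (c @ [b]) x"
  by (simp add: freq_def occ_pos_iff)

lemma esc_2_freq: "esc x c = 2 \<Longrightarrow> 0 < freq x c b"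
proof -
  assume "esc x c = 2"
  then have "{b. 0 < freq x c b} = UNIV"
    using card_subset_eq[of "UNIV :: bool set" "{b. 0 < freq x c b}"] by (simp add: esc_def)
  then show ?thesis by blast
qed

lemma esc_le: "esc x c \<le> 2"
  using card_mono[of "UNIV :: bool set" "{b. 0 < freq x c b}"] by (simp add: esc_def)

lemma esc_pos:
  assumes "stored x c" "c \<noteq> []" shows "0 < esc x c"
proof -
  have "sublist c (butlast x)" using assms by (simp add: stored_def occ_pos_iff)
  then obtain u v where uv: "butlast x = u @ c @ v" by (auto simp: sublist_def)
  then have "x \<noteq> []" using assms(2) by (cases x) auto
  then have x: "x = u @ c @ v @ [last x]" using uv append_butlast_last_id[of x] by simp
  then obtain b r where "v @ [last x] = b # r" by (cases "v @ [last x]") auto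
  then have "x = u @ (c @ [b]) @ r" using x by simp
  then have "sublist (c @ [b]) x" unfolding sublist_def by blast
  then have "b \<in> {b. 0 < freq x c b}" by (simp add: freq_pos_iff)
  then show ?thesis unfolding esc_def by (auto simp: card_gt_0_iff)
qed

section \<open>Suffixes and the chain of contexts\<close>

lemma length_sfx: "k \<le> length x \<Longrightarrow> length (sfx x k) = k"
  by (simp add: sfx_def)

lemma suffix_sfx: "suffix (sfx x k) x"
  by (simp add: sfx_def suffix_drop)

lemma sfx_append: "sfx (u @ w) (length w) = w"
  by (simp add: sfx_def)

lemma suffix_sfx_sfx: "l \<le> k \<Longrightarrow> suffix (sfx x l) (sfx x k)"
  unfolding sfx_def by (metis diff_le_mono2 drop_drop le_add_diff_inverse2 suffix_drop)

lemma finite_rel_lens: "finite (rel_lens x)"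
  by (simp add: rel_lens_def)

text \<open>Exposes the largest element of a descending enumeration: first the current context,
  later the next shorter relevant one.\<close>

lemma filter_rev_upt:
  assumes "K \<in> A" "K < N" "\<And>k. k \<in> A \<Longrightarrow> k < N \<Longrightarrow> k \<le> K"
  shows "filter (\<lambda>k. k \<in> A) (rev [0..<N]) = K # filter (\<lambda>k. k \<in> A) (rev [0..<K])"
proof -
  have "[0..<N] = [0..<K] @ K # [Suc K..<N]"
    using assms(2) upt_add_eq_append[of 0 K "N - K"] upt_conv_Cons[of K N] by simp
  moreover have "filter (\<lambda>k. k \<in> A) (rev [Suc K..<N]) = []"
    using assms(3) by (force simp: filter_empty_conv)
  ultimately show ?thesis using assms(1) by simp
qed

lemma chain_eq:
  assumes "cur_len x \<in> rel_lens x"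
  shows "chain x = cur_len x # filter (\<lambda>k. k \<in> rel_lens x) (rev [0..<cur_len x])"
proof -
  have "chain x = filter (\<lambda>k. k \<in> {k \<in> rel_lens x. k \<le> cur_len x}) (rev [0..<Suc (length x)])"
    by (simp add: chain_def)
  also have "\<dots> = cur_len x # filter (\<lambda>k. k \<in> {k \<in> rel_lens x. k \<le> cur_len x}) (rev [0..<cur_len x])"
    using assms by (intro filter_rev_upt) (auto simp: rel_lens_def)
  also have "filter (\<lambda>k. k \<in> {k \<in> rel_lens x. k \<le> cur_len x}) (rev [0..<cur_len x]) =
      filter (\<lambda>k. k \<in> rel_lens x) (rev [0..<cur_len x])"
    by (rule filter_cong) auto
  finally show ?thesis .
qed

lemma neg_log_ratio_le:
  assumes "0 < f" "real T + real e \<le> B" and that: "0 < T + e"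
  shows "- log 2 (real f / real (T + e)) \<le> log 2 B"
proof -
  have "real (T + e) / real f \<le> B / 1"
    using assms that by (intro frac_le) auto
  then have "log 2 (real (T + e) / real f) \<le> log 2 B"
    using assms that by (intro log_mono) auto
  also have "log 2 (real (T + e) / real f) = - log 2 (real f / real (T + e))"
    using assms that by (simp add: log_divide)
  finally show ?thesis .
qed

lemma enc_2:
  assumes "esc x (sfx x k) = 2" "real (tot x (sfx x k)) + 2 \<le> B"
  shows "enc x b (k # ks) \<le> log 2 B"
  using esc_2_freq[OF assms(1), of b] neg_log_ratio_le[of "freq x (sfx x k) b" "tot x (sfx x k)" 2 B] assms
  by (simp add: Let_def)

text \<open>When every word of length at most \<open>m + 1\<close> has occurred, at most one escape is
  needed: the current context has length at least \<open>m\<close>, and the next shorter one is not deterministic.\<close>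
lemma ppm_bit_le:
  assumes m: "1 \<le> m"
    and all: "\<And>w. length w \<le> m + 1 \<Longrightarrow> sublist w x"
    and M: "\<And>w. m + 1 \<le> length w \<Longrightarrow> occ w x \<le> M"
  shows "ppm_bit x b \<le> 2 * log 2 (real (2 * M + 2))"
proof -
  \<comment> \<open>Bounds every denominator that arises: total count at most \<open>2 * M\<close>,
    escape count at most 2.\<close>
  define B where "B = real (2 * M + 2)"
  have B: "1 \<le> B" "0 \<le> log 2 B" by (simp_all add: B_def)
  have len: "m \<le> length x"
    using sublist_length_le[OF all[of "replicate m False"]] by simp
  have low_rel: "k \<in> rel_lens x" and low_esc: "esc x (sfx x k) = 2" if "k \<le> m" for k
  proof -
    have l: "length (sfx x k) = k" using that len by (simp add: length_sfx)
    have f: "0 < freq x c b" if "length c \<le> m" for c b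
      using that by (simp add: freq_pos_iff all)
    have "{b. 0 < freq x (sfx x k) b} = UNIV" using f that l by simp
    then show "esc x (sfx x k) = 2" by (simp add: esc_def)
    have "2 \<le> occ (butlast (sfx x k)) x"
    proof -
      have "length (butlast (sfx x k)) \<le> m" using l that by simp
      from f[OF this, of False] f[OF this, of True] show ?thesis
        using occ_snoc_sum[of "butlast (sfx x k)" x] by (simp add: freq_def)
    qed
    moreover have "0 < occ (sfx x k) (butlast x)"
      using all[of "sfx x k @ [False]"] l that by (simp add: occ_pos_iff sublist_snoc_butlast)
    ultimately show "k \<in> rel_lens x"
      using that len by (simp add: rel_lens_def relevant_def stored_def suffix_sfx)
  qed
  have tot: "real (tot x (sfx x k)) \<le> 2 * real M" if "k \<in> rel_lens x" "m \<le> k" for k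
  proof -
    have "length (sfx x k) = k" using that(1) by (simp add: rel_lens_def length_sfx)
    then have "tot x (sfx x k) \<le> 2 * M"
      using M[of "sfx x k @ [False]"] M[of "sfx x k @ [True]"] that(2) by (simp add: tot_def freq_def)
    then show ?thesis by simp
  qed
  have esc2: "esc x (sfx x k) = 2"
    if "k \<in> rel_lens x" "m \<le> k" "\<not> deterministic x (sfx x k)" for k
  proof -
    have "sfx x k \<noteq> []" using that m by (auto simp: rel_lens_def dest!: length_sfx)
    then have "0 < esc x (sfx x k)" using that by (intro esc_pos) (auto simp: rel_lens_def relevant_def)
    then show ?thesis using esc_le[of x "sfx x k"] that(3) by (simp add: deterministic_def)
  qed
  define Det where "Det = {k \<in> rel_lens x. deterministic x (sfx x k)}"
  have fD: "finite Det" using finite_rel_lens[of x] by (simp add: Det_def)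
  show ?thesis
  proof (cases "Det = {}")
    case True
    have c: "cur_len x = Max (rel_lens x)" using True by (simp add: cur_len_def Det_def)
    have "cur_len x \<in> rel_lens x" "m \<le> cur_len x"
      unfolding c using low_rel[of m] finite_rel_lens[of x] by (auto intro: Max_in)
    moreover have "\<not> deterministic x (sfx x (cur_len x))"
      using True calculation by (auto simp: Det_def)
    ultimately have "enc x b (chain x) \<le> log 2 B"
      unfolding chain_eq[OF \<open>cur_len x \<in> rel_lens x\<close>]
      using tot[of "cur_len x"] by (intro enc_2 esc2) (auto simp: B_def)
    then have "enc x b (chain x) \<le> 2 * log 2 B" using B(2) by linarith
    then show ?thesis by (simp add: ppm_bit_def B_def)
  next
    case False
    have c: "cur_len x = Min Det" using False by (simp add: cur_len_def Det_def)
    have cD: "cur_len x \<in> Det" unfolding c by (rule Min_in[OF fD False])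
    have min: "cur_len x \<le> k" if "k \<in> Det" for k unfolding c by (rule Min_le[OF fD that])
    have cr: "cur_len x \<in> rel_lens x" using cD by (simp add: Det_def)
    have e1: "esc x (sfx x (cur_len x)) = 1" using cD by (simp add: Det_def deterministic_def)
    have mc: "m < cur_len x"
      using low_esc[of "cur_len x"] e1 by (metis not_le_imp_less numeral_eq_one_iff semiring_norm(85))
    define K where "K = Max {k \<in> rel_lens x. k < cur_len x}"
    have fK: "finite {k \<in> rel_lens x. k < cur_len x}" using finite_rel_lens[of x] by simp
    have mK: "m \<in> {k \<in> rel_lens x. k < cur_len x}" using low_rel[of m] mc by simp
    then have K: "K \<in> {k \<in> rel_lens x. k < cur_len x}" unfolding K_def using fK by (intro Max_in) auto
    have "m \<le> K" unfolding K_def by (rule Max_ge[OF fK mK])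
    \<comment> \<open>\<open>K\<close> is shorter than the shortest deterministic context. Both bits
      have therefore been seen there, and no second escape can occur.\<close>
    have "\<not> deterministic x (sfx x K)" using min[of K] K by (auto simp: Det_def)
    then have K2: "esc x (sfx x K) = 2" using K \<open>m \<le> K\<close> by (intro esc2) auto
    have ch: "chain x = cur_len x # K # filter (\<lambda>k. k \<in> rel_lens x) (rev [0..<K])"
      unfolding chain_eq[OF cr] using K fK
      by (subst filter_rev_upt[of K "rel_lens x" "cur_len x"]) (auto simp: K_def)
    have t1: "real (tot x (sfx x (cur_len x))) + real 1 \<le> B"
      using tot[OF cr] mc by (simp add: B_def)
    have r: "enc x b (K # filter (\<lambda>k. k \<in> rel_lens x) (rev [0..<K])) \<le> log 2 B"
      using tot[of K] K \<open>m \<le> K\<close> by (intro enc_2 K2) (auto simp: B_def)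
    have "enc x b (chain x) \<le> log 2 B + log 2 B"
    proof (cases "0 < freq x (sfx x (cur_len x)) b")
      case True
      then show ?thesis
        using neg_log_ratio_le[OF True t1] B(2)
        by (simp only: ch enc.simps(2)[of x b "cur_len x"] e1 Let_def if_True) simp
    next
      case False
      then show ?thesis
        using neg_log_ratio_le[of 1, OF _ t1] r by (simp only: ch enc.simps(2)[of x b "cur_len x"] e1 Let_def if_False) simp
    qed
    then show ?thesis by (simp add: ppm_bit_def B_def)
  qed
qed

text \<open>The current context is some deterministic one of length at most \<open>r\<close>, so the
  count bound is assumed for all these lengths. There only \<open>b\<close> has been seen, and the
  cost log((f+1)/f) decreases in the count f.\<close>

lemma ppm_bit_deterministic:
  assumes r: "r \<in> rel_lens x" "deterministic x (sfx x r)"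
    and j: "0 < j" "\<And>l. l \<le> r \<Longrightarrow> j \<le> freq x (sfx x l) b"
  shows "ppm_bit x b \<le> log 2 (real (j + 1) / real j)"
proof -
  define Det where "Det = {k \<in> rel_lens x. deterministic x (sfx x k)}"
  define c where "c = cur_len x"
  have fD: "finite Det" using finite_rel_lens[of x] by (simp add: Det_def)
  have rD: "r \<in> Det" using r by (simp add: Det_def)
  then have c: "c = Min Det" by (auto simp: c_def cur_len_def Det_def)
  have cD: "c \<in> Det" unfolding c using rD by (intro Min_in[OF fD]) auto
  have "c \<le> r" unfolding c by (rule Min_le[OF fD rD])
  define f where "f = freq x (sfx x c) b"
  have jf: "j \<le> f" using j(2)[OF \<open>c \<le> r\<close>] by (simp add: f_def)
  have e1: "esc x (sfx x c) = 1" using cD by (simp add: Det_def deterministic_def)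
  have "freq x (sfx x c) (\<not> b) = 0"
  proof (rule ccontr)
    assume "freq x (sfx x c) (\<not> b) \<noteq> 0"
    moreover have "freq x (sfx x c) b \<noteq> 0" using jf j(1) by (simp add: f_def)
    ultimately have "freq x (sfx x c) d \<noteq> 0" for d by (cases "d = b") auto
    then have "UNIV \<subseteq> {b. 0 < freq x (sfx x c) b}" by simp
    then have "esc x (sfx x c) = 2" by (simp add: esc_def top.extremum_unique)
    then show False using e1 by simp
  qed
  then have t: "tot x (sfx x c) = f" by (cases b) (simp_all add: tot_def f_def)
  have "ppm_bit x b = - log 2 (real f / real (f + 1))"
    using cD jf j(1) chain_eq[of x] by (simp add: ppm_bit_def Det_def e1 t f_def[symmetric] Let_def flip: c_def)
  also have "\<dots> = log 2 (real (f + 1) / real f)" using jf j(1) by (simp add: log_divide)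
  also have "\<dots> \<le> log 2 (real (j + 1) / real j)"
    using jf j(1) by (intro log_mono) (simp_all add: field_simps)
  finally show ?thesis .
qed

subsection \<open>Cost of encoding a segment\<close>

lemma ppm_cost_snoc: "ppm_cost x (v @ [b]) = ppm_cost x v + ppm_bit (x @ v) b"
  by (simp add: ppm_cost_def nth_append)

lemma ppm_cost_append: "ppm_cost x (u @ v) = ppm_cost x u + ppm_cost (x @ u) v"
proof (induction v rule: rev_induct)
  case (snoc b v)
  have "ppm_cost x (u @ v @ [b]) = ppm_cost x (u @ v) + ppm_bit (x @ u @ v) b"
    using ppm_cost_snoc[of x "u @ v" b] by simp
  then show ?case by (simp add: ppm_cost_snoc snoc)
qed (simp add: ppm_cost_def)

lemma ppm_cost_le:
  assumes "\<And>i. i < length y \<Longrightarrow> ppm_bit (x @ take i y) (y ! i) \<le> L"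
  shows "ppm_cost x y \<le> real (length y) * L"
  using sum_bounded_above[of "{..<length y}" "\<lambda>i. ppm_bit (x @ take i y) (y ! i)" L] assms
  by (simp add: ppm_cost_def)

text \<open>The context is the part of \<open>tl (db n)\<close> read so far. It contains the anchor,
  so each of its occurrences starts a copy of \<open>tl (db n)\<close>, which determines the next
  bit.\<close>

lemma ppm_bit_tl_db:
  assumes n: "3 \<le> n" and pre: "prefix (x @ take r (tl (db n))) (S_tail n 1)"
    and r: "2 * n - 1 \<le> r" "r < length (tl (db n))"
    and j: "0 < j" "\<And>w. w \<noteq> [] \<Longrightarrow> sublist w (tl (db n)) \<Longrightarrow> j \<le> occ w x"
  shows "ppm_bit (x @ take r (tl (db n))) (tl (db n) ! r) \<le> log 2 (real (j + 1) / real j)"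
proof -
  define T where "T = tl (db n)"
  define c where "c = take r T"
  define y where "y = x @ c"
  have lc: "length c = r" using r by (simp add: c_def T_def)
  have cT: "c @ [T ! r] = take (Suc r) T" using r by (simp add: c_def T_def take_Suc_conv_app_nth)
  have c_ne: "c \<noteq> []" "butlast c \<noteq> []" using lc r n by (auto dest: arg_cong[where f = length])
  have sub_c: "sublist c T" by (simp add: c_def)
  have sub_bc: "sublist (butlast c) c" by (simp add: butlast_conv_take)
  have sfx_r: "sfx y r = c" using sfx_append[of x c] lc by (simp add: y_def)
  have freq: "j \<le> freq y (sfx y l) (T ! r)" if "l \<le> r" for l
  proof -
    have "suffix (sfx y l) c" using suffix_sfx_sfx[OF that, of y] by (simp add: sfx_r)
    then have "sublist (sfx y l @ [T ! r]) (take (Suc r) T)"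
      unfolding cT[symmetric] by (simp add: suffix_imp_sublist)
    then have "sublist (sfx y l @ [T ! r]) T" by (metis sublist_order.order_trans sublist_take)
    then have "j \<le> occ (sfx y l @ [T ! r]) x" by (intro j) (simp_all add: T_def)
    also have "\<dots> \<le> occ (sfx y l @ [T ! r]) y" by (rule occ_mono_prefix) (simp add: y_def)
    finally show ?thesis by (simp add: freq_def)
  qed
  have "r \<in> rel_lens y"
  proof -
    \<comment> \<open>One occurrence lies in an earlier copy and one in the current copy, which
      makes the two required for a stored context.\<close>
    have "1 \<le> occ (butlast c) x"
      using j(2)[of "butlast c"] j(1) c_ne sublist_order.order_trans[OF sub_bc sub_c] by (simp add: T_def)
    moreover have "1 \<le> occ (butlast c) c" using sub_bc by (simp add: Suc_le_eq occ_pos_iff)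
    ultimately have "2 \<le> occ (butlast c) y" using occ_append_ge[OF c_ne(2), of x c] by (simp add: y_def)
    moreover have "sublist c (butlast y)"
    proof -
      have "0 < occ c x" using j(2)[of c] j(1) c_ne sub_c by (simp add: T_def)
      then have "sublist c (x @ butlast c)"
        by (metis occ_pos_iff sublist_append_rightI sublist_order.order_trans)
      then show ?thesis using c_ne by (simp add: y_def butlast_append)
    qed
    ultimately show ?thesis using lc
      by (simp add: rel_lens_def relevant_def stored_def sfx_r occ_pos_iff) (simp add: y_def suffix_def)
  qed
  moreover have "deterministic y (sfx y r)"
  proof -
    have "b = T ! r" if b: "0 < freq y c b" for b
    proof -
      obtain u v where "y = u @ (c @ [b]) @ v" using b by (auto simp: freq_pos_iff sublist_def)
      moreover obtain s where "S_tail n 1 = y @ s"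
        using pre by (auto simp: prefix_def y_def c_def T_def)
      ultimately have d: "drop (length u) (S_tail n 1) = c @ b # v @ s" by simp
      have "c = take (2 * n - 1) T @ drop (2 * n - 1) c"
        using r by (metis append_take_drop_id c_def min.absorb1 take_take)
      then have "prefix (take (2 * n - 1) (tl (db n))) (drop (length u) (S_tail n 1))"
        unfolding d T_def by (metis append.assoc prefixI)
      then have "prefix T (drop (length u) (S_tail n 1))"
        using anchored_S_tail[OF n, of 1] n by (simp add: anchored_def T_def)
      then obtain q where "c @ b # v @ s = T @ q" unfolding d by (auto simp: prefix_def)
      then have "(c @ b # v @ s) ! r = (T @ q) ! r" by simp
      then show ?thesis using lc r by (simp add: nth_append T_def)
    qed
    moreover have "0 < freq y c (T ! r)" using freq[of r] j(1) by (simp add: sfx_r)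
    ultimately have "{b. 0 < freq y c b} = {T ! r}" by blast
    then show ?thesis by (simp add: deterministic_def esc_def sfx_r)
  qed
  ultimately show ?thesis
    using ppm_bit_deterministic[OF _ _ j(1) freq] by (simp add: y_def c_def T_def)
qed

text \<open>In the \<open>j\<close>-th copy of \<open>db n\<close> only the first \<open>2 n\<close> bits can be expensive; for every other position,
  the costs over all copies telescope.\<close>
lemma ppm_cost_blocks:
  assumes n: "3 \<le> n" and L: "0 \<le> L"
    and bit: "\<And>x b. prefix (S_prefix n) x \<Longrightarrow> prefix (x @ [b]) (S_prefix n @ S_seg n) \<Longrightarrow> ppm_bit x b \<le> L"
    and bs: "set bs \<subseteq> {db n, tl (db n)}"
    and x: "prefix (S_prefix n) x" "prefix (x @ concat bs) (S_prefix n @ S_seg n)"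
    and j: "0 < j" "\<And>w. w \<noteq> [] \<Longrightarrow> sublist w (tl (db n)) \<Longrightarrow> j \<le> occ w x"
  shows "ppm_cost x (concat bs) \<le>
    real (length bs) * (2 * real n) * L + 2 ^ n * log 2 (real (j + length bs) / real j)"
  using bs x j
proof (induction bs arbitrary: x j)
  case Nil
  then show ?case by (simp add: ppm_cost_def)
next
  case (Cons u bs)
  have n1: "1 \<le> n" using n by simp
  define T where "T = tl (db n)"
  \<comment> \<open>\<open>p\<close> is the leading zero that may have been dropped. With the anchor
    it forms the expensive head \<open>h\<close> of at most \<open>2 * n\<close> letters.\<close>
  obtain p where u: "u = p @ T" and p: "length p \<le> 1"
  proof (cases "u = T")
    case False
    then have "u = db n" using Cons.prems by (simp add: T_def)
    then have "u = [hd (db n)] @ T" using db_ne[OF n1] by (simp add: T_def)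
    then show ?thesis using that by force
  qed (use that[of "[]"] in simp)
  define h where "h = p @ take (2 * n - 1) T"
  define t where "t = drop (2 * n - 1) T"
  have ht: "u = h @ t" by (simp add: h_def t_def u)
  have full: "prefix (x @ h @ t) (S_prefix n @ S_seg n)"
    using Cons.prems(3) by (auto simp: ht prefix_def)
  have tail: "prefix (S_prefix n @ S_seg n) (S_tail n 1)" by (simp only: S_tail_1[OF n1]) simp
  have "ppm_cost x h \<le> real (length h) * L"
  proof (rule ppm_cost_le, rule bit)
    fix i assume i: "i < length h"
    show "prefix (S_prefix n) (x @ take i h)" using Cons.prems(2) by (auto simp: prefix_def)
    have "(x @ take i h) @ [h ! i] = x @ take (Suc i) h" using i by (simp add: take_Suc_conv_app_nth)
    also have "prefix \<dots> (x @ h @ t)" by (simp add: take_is_prefix prefix_prefix)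
    finally show "prefix ((x @ take i h) @ [h ! i]) (S_prefix n @ S_seg n)"
      using full by (rule prefix_order.trans)
  qed
  also have "real (length h) * L \<le> 2 * real n * L"
    using p n L by (intro mult_right_mono) (auto simp: h_def)
  finally have c1: "ppm_cost x h \<le> 2 * real n * L" .
  have "ppm_cost (x @ h) t \<le> real (length t) * log 2 (real (j + 1) / real j)"
  proof (rule ppm_cost_le)
    fix i assume i: "i < length t"
    have l: "2 * n - 1 + i < length T" using i by (simp add: t_def)
    have tk: "(x @ h) @ take i t = (x @ p) @ take (2 * n - 1 + i) T"
      by (simp add: h_def t_def take_add)
    have "ppm_bit ((x @ p) @ take (2 * n - 1 + i) (tl (db n))) (tl (db n) ! (2 * n - 1 + i)) \<le>
        log 2 (real (j + 1) / real j)"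
    proof (rule ppm_bit_tl_db[OF n])
      have "prefix ((x @ p) @ take (2 * n - 1 + i) T) (x @ h @ t)"
        by (simp add: ht[symmetric] u take_is_prefix)
      then show "prefix ((x @ p) @ take (2 * n - 1 + i) (tl (db n))) (S_tail n 1)"
        using full tail unfolding T_def by (meson prefix_order.trans)
      fix w assume "w \<noteq> []" "sublist w (tl (db n))"
      then have "j \<le> occ w x" by (rule Cons.prems)
      also have "\<dots> \<le> occ w (x @ p)" by (rule occ_mono_prefix) simp
      finally show "j \<le> occ w (x @ p)" .
    qed (use l Cons.prems in \<open>auto simp: T_def\<close>)
    moreover have "t ! i = T ! (2 * n - 1 + i)" using l by (simp add: t_def)
    ultimately show "ppm_bit ((x @ h) @ take i t) (t ! i) \<le> log 2 (real (j + 1) / real j)"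
      by (simp only: tk T_def)
  qed
  also have "\<dots> \<le> 2 ^ n * log 2 (real (j + 1) / real j)"
  proof (rule mult_right_mono)
    have "length t \<le> 2 ^ n" by (simp add: t_def T_def length_db[OF n1])
    then show "real (length t) \<le> 2 ^ n" by (metis of_nat_le_iff of_nat_numeral of_nat_power)
    show "0 \<le> log 2 (real (j + 1) / real j)" using Cons.prems(4) by simp
  qed
  finally have c2: "ppm_cost (x @ h) t \<le> 2 ^ n * log 2 (real (j + 1) / real j)" .
  have c3: "ppm_cost (x @ u) (concat bs) \<le> real (length bs) * (2 * real n) * L +
      2 ^ n * log 2 (real (j + 1 + length bs) / real (j + 1))"
  proof (rule Cons.IH)
    \<comment> \<open>Reading the block \<open>u\<close> adds an occurrence of each subword, so the
      induction continues with \<open>j + 1\<close>.\<close>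
    fix w assume w: "w \<noteq> []" "sublist w (tl (db n))"
    then have "sublist w u" unfolding u T_def by (metis sublist_append_leftI sublist_order.order_trans)
    then have "1 \<le> occ w u" by (simp add: Suc_le_eq occ_pos_iff)
    then show "j + 1 \<le> occ w (x @ u)"
      using Cons.prems(5)[OF w] occ_append_ge[OF w(1), of x u] by simp
  qed (use Cons.prems in \<open>auto simp: prefix_def\<close>)
  have "ppm_cost x (concat (u # bs)) = ppm_cost x h + ppm_cost (x @ h) t + ppm_cost (x @ u) (concat bs)"
    by (simp add: ppm_cost_append ht)
  also have "\<dots> \<le> real (length (u # bs)) * (2 * real n) * L +
      2 ^ n * (log 2 (real (j + 1) / real j) + log 2 (real (j + 1 + length bs) / real (j + 1)))"
    using c1 c2 c3 by (simp add: algebra_simps)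
  also have "log 2 (real (j + 1) / real j) + log 2 (real (j + 1 + length bs) / real (j + 1)) =
      log 2 (real (j + length (u # bs)) / real j)"
    using Cons.prems(4) by (simp add: log_divide)
  finally show ?case .
qed

text \<open>The first copy is charged \<open>L\<close> per bit. It supplies \<open>j = 1\<close> for
  the other \<open>n - 1\<close> copies, whose cheap bits telescope to log n per position. The
  trailing zeros again cost \<open>L\<close> each.\<close>

lemma ppm_cost_S_seg:
  assumes n: "3 \<le> n" and L: "0 \<le> L"
    and bit: "\<And>x b. prefix (S_prefix n) x \<Longrightarrow> prefix (x @ [b]) (S_prefix n @ S_seg n) \<Longrightarrow> ppm_bit x b \<le> L"
  shows "ppm_cost (S_prefix n) (S_seg n) \<le> (2 ^ n + 2 * real n ^ 2) * L + 2 ^ n * log 2 (real n)"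
proof -
  have n1: "1 \<le> n" using n by simp
  obtain bs z where S: "S_seg n = concat (db n # bs) @ replicate z False" "z < n"
    "length bs = n - 1" "set bs \<subseteq> {db n, tl (db n)}"
    by (rule S_seg_blocks[OF n1])
  define X where "X = S_prefix n"
  have easy: "ppm_cost (X @ u) v \<le> real (length v) * L" if "prefix (u @ v) (S_seg n)" for u v
  proof (rule ppm_cost_le, rule bit)
    fix i assume i: "i < length v"
    show "prefix (S_prefix n) ((X @ u) @ take i v)" by (simp add: X_def)
    have "((X @ u) @ take i v) @ [v ! i] = X @ u @ take (Suc i) v" using i by (simp add: take_Suc_conv_app_nth)
    also have "prefix \<dots> (X @ u @ v)" by (simp add: take_is_prefix)
    also have "prefix \<dots> (S_prefix n @ S_seg n)" using that by (simp add: X_def)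
    finally show "prefix (((X @ u) @ take i v) @ [v ! i]) (S_prefix n @ S_seg n)" .
  qed
  have "ppm_cost X (db n) \<le> 2 ^ n * L"
    using easy[of "[]" "db n"] by (simp add: S length_db[OF n1])
  moreover have "ppm_cost (X @ db n) (concat bs) \<le>
      real (length bs) * (2 * real n) * L + 2 ^ n * log 2 (real (1 + length bs) / real 1)"
  proof (rule ppm_cost_blocks[OF n L bit])
    fix w assume w: "w \<noteq> []" "sublist w (tl (db n))"
    then have "sublist w (db n)" by (metis sublist_order.order_trans sublist_tl)
    then have "sublist w (X @ db n)" by (metis sublist_append_leftI sublist_order.order_trans)
    then show "1 \<le> occ w (X @ db n)" by (simp add: Suc_le_eq occ_pos_iff)
  qed (use S in \<open>auto simp: X_def\<close>)
  moreover have "ppm_cost (X @ db n @ concat bs) (replicate z False) \<le> real z * L"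
    using easy[of "db n @ concat bs" "replicate z False"] by (simp add: S)
  ultimately have "ppm_cost X (S_seg n) \<le> 2 ^ n * L + (real (n - 1) * (2 * real n) * L +
      2 ^ n * log 2 (real n)) + real z * L"
    using S n by (simp add: ppm_cost_append)
  also have "\<dots> = (2 ^ n + (real (n - 1) * (2 * real n) + real z)) * L + 2 ^ n * log 2 (real n)"
    by (simp add: algebra_simps)
  also have "\<dots> \<le> (2 ^ n + 2 * real n ^ 2) * L + 2 ^ n * log 2 (real n)"
  proof -
    have "real (n - 1) * (2 * real n) + real z \<le> 2 * real n ^ 2"
      using S(2) n by (simp add: of_nat_diff algebra_simps power2_eq_square)
    then show ?thesis using L by (intro add_right_mono mult_right_mono) auto
  qed
  finally show ?thesis by (simp add: X_def)
qed

lemma ppm_bit_S: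
  assumes n: "64 \<le> n" and x: "prefix (S_prefix n) x" "prefix (x @ [b]) (S_prefix n @ S_seg n)"
  shows "ppm_bit x b \<le> log 2 (real n ^ 5)"
proof -
  define M where "M = 3 * n * n + n"
  have "ppm_bit x b \<le> 2 * log 2 (real (2 * M + 2))"
  \<comment> \<open>All words of length at most \<open>n - 1\<close> already occur in
    \<open>S_seg (n - 1)\<close>.\<close>
  proof (rule ppm_bit_le[where m = "n - 2"])
    fix w :: "bool list" assume "length w \<le> n - 2 + 1"
    then have "sublist w (S_prefix n)" using n by (intro sublist_S_prefix) auto
    then show "sublist w x"
      by (rule sublist_order.order_trans) (rule prefix_imp_sublist[OF x(1)])
  next
    fix w :: "bool list" assume w: "n - 2 + 1 \<le> length w"
    have "prefix x (x @ [b])" by simp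
    also note x(2)
    also have "prefix (S_prefix n @ S_seg n) (S_tail n 1)"
      using n by (subst S_tail_1) simp_all
    finally have "prefix x (S_tail n 1)" .
    then have "occ w x \<le> occ w (S_tail n 1)" by (rule occ_mono_prefix)
    also have "\<dots> \<le> 3 * n * (Suc n - 1) + n" using w n by (intro occ_S_tail) auto
    finally show "occ w x \<le> M" by (simp add: M_def)
  qed (use n in simp)
  also have "\<dots> = log 2 (real (2 * M + 2) ^ 2)" by (simp add: log_nat_power)
  also have "\<dots> \<le> log 2 (real n ^ 5)"
  proof (rule log_mono)
    have "2 * M + 2 \<le> 8 * n ^ 2"
    proof -
      have "64 * n \<le> n * n" using n by simp
      moreover have "2 * M + 2 = 6 * (n * n) + 2 * n + 2" by (simp add: M_def)
      ultimately show ?thesis using n unfolding power2_eq_square by linarith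
    qed
    then have "(2 * M + 2) ^ 2 \<le> (8 * n ^ 2) ^ 2" by (rule power_mono) simp
    also have "\<dots> = 64 * n ^ 4" by (simp add: power_mult_distrib)
    \<comment> \<open>The threshold 64 is the constant \<open>8 ^ 2\<close> absorbed here by one
      factor \<open>n\<close>.\<close>
    also have "\<dots> \<le> n * n ^ 4" using n by (intro mult_right_mono) auto
    also have "\<dots> = n ^ 5" by (simp add: eval_nat_numeral)
    finally have "real ((2 * M + 2) ^ 2) \<le> real (n ^ 5)" by (rule of_nat_mono)
    then show "real (2 * M + 2) ^ 2 \<le> real n ^ 5" by simp
  qed simp_all
  finally show ?thesis .
qed

theorem theorem1:
  shows "\<forall>\<^sub>F n in sequentially.
    ppm_cost (S_prefix n) (S_seg n)
      \<le> (2 ^ n + 2 * real n + real n ^ 2) * log 2 (real n ^ 5)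
        + log 2 ((real n - 1) ^ n * real n ^ (2 ^ (n + 1)))"
proof (rule eventually_sequentiallyI[of 64])
  fix n :: nat assume n: "64 \<le> n"
  define l where "l = log 2 (real n)"
  have l: "0 \<le> l" using n by (simp add: l_def)
  have L: "log 2 (real n ^ 5) = 5 * l" using n by (simp add: l_def log_nat_power)
  have "(\<lambda>k. 5 * k ^ 2 \<le> (2::nat) ^ k) n"
    using n
  proof (induction n rule: dec_induct)
    case (step k)
    have "5 * (Suc k) ^ 2 \<le> 2 * (5 * k ^ 2)"
    proof -
      have "64 * k \<le> k * k" using step by simp
      moreover have "(Suc k) ^ 2 = k * k + 2 * k + 1" by (simp add: power2_eq_square)
      ultimately show ?thesis using step(1) unfolding power2_eq_square[of k] by linarith
    qed
    then show ?case using step by simp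
  qed simp
  then have "real (5 * n ^ 2) \<le> real (2 ^ n)" by (simp only: of_nat_le_iff)
  then have pw: "5 * real n ^ 2 \<le> 2 ^ n" by simp
  have R: "2 ^ (n + 1) * l \<le> log 2 ((real n - 1) ^ n * real n ^ (2 ^ (n + 1)))"
  proof -
    have "log 2 ((real n - 1) ^ n * real n ^ (2 ^ (n + 1))) =
        real n * log 2 (real n - 1) + 2 ^ (n + 1) * l"
      using n by (simp add: log_mult log_nat_power l_def)
    moreover have "0 \<le> log 2 (real n - 1)" using n by simp
    ultimately show ?thesis by simp
  qed
  have "ppm_cost (S_prefix n) (S_seg n) \<le> (2 ^ n + 2 * real n ^ 2) * (5 * l) + 2 ^ n * l"
    using ppm_cost_S_seg[of n "5 * l"] ppm_bit_S[OF n] n l by (simp add: L l_def)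
  \<comment> \<open>Half of the term \<open>2 * real n ^ 2\<close> is moved to the last summand,
    where \<open>pw\<close> absorbs it into a second \<open>2 ^ n * l\<close>. Together these give
    the exponent \<open>2 ^ (n + 1)\<close> in the claimed bound.\<close>
  also have "\<dots> = (2 ^ n + real n ^ 2) * (5 * l) + (2 ^ n + 5 * real n ^ 2) * l"
    by (simp add: algebra_simps)
  also have "\<dots> \<le> (2 ^ n + 2 * real n + real n ^ 2) * (5 * l) + 2 ^ (n + 1) * l"
    using pw l by (intro add_mono mult_right_mono) auto
  finally show "ppm_cost (S_prefix n) (S_seg n)
      \<le> (2 ^ n + 2 * real n + real n ^ 2) * log 2 (real n ^ 5)
        + log 2 ((real n - 1) ^ n * real n ^ (2 ^ (n + 1)))"
    using R by (simp add: L)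
qed

end
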